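(* Let $X_1\in B_m$ and $X_2\in B_n$, and let $X=X_1\,\mathrm{sh}_m(X_2)\in B_{m+n}$. Then $X$ is strongly quasipositive if and only if both $X_1$ and $X_2$ are strongly quasipositive.
   Context: $B_n$ is the braid group on $n$ strings with Artin generators $\sigma_1,\dots,\sigma_{n-1}$. The shift homomorphism $\mathrm{sh}_m:B_n\to B_{m+n}$ is defined on generators by $\sigma_k\mapsto\sigma_{m+k}$; $B_m$ is viewed as a subgroup of $B_{m+n}$ via $\sigma_k\mapsto\sigma_k$. For $j\le k$ put $\tau_{k,j}=\sigma_k\sigma_{k-1}\cdots\sigma_j$ and $\sigma_{j,k+1}=\tau_{k,j}\sigma_j\tau_{k,j}^{-1}$ (band generators of the relevant braid group); a braid is strongly quasipositive if it is a product of band generators. *)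

theory Defs
  imports Main
begin

text \<open>Braid words: a letter (i, True) stands for the Artin generator sigma_i,
  (i, False) for its inverse.  Generators are indexed 1 .. n-1 in B_n.\<close>

type_synonym bword = "(nat \<times> bool) list"

definition braid_word :: "nat \<Rightarrow> bword \<Rightarrow> bool" where
  "braid_word n w \<longleftrightarrow> (\<forall>(i, b) \<in> set w. 1 \<le> i \<and> i < n)"

definition inv_word :: "bword \<Rightarrow> bword" where
  "inv_word w = rev (map (\<lambda>(i, b). (i, \<not> b)) w)"

inductive braid_step :: "nat \<Rightarrow> bword \<Rightarrow> bword \<Rightarrow> bool" for n where
  cancel: "\<lbrakk>1 \<le> i; i < n\<rbrakk> \<Longrightarrow>
     braid_step n (u @ [(i, b), (i, \<not> b)] @ v) (u @ v)"
| comm: "\<lbrakk>1 \<le> i; i < n; 1 \<le> j; j < n; i + 2 \<le> j\<rbrakk> \<Longrightarrow>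
     braid_step n (u @ [(i, True), (j, True)] @ v) (u @ [(j, True), (i, True)] @ v)"
| braid: "\<lbrakk>1 \<le> i; i + 1 < n\<rbrakk> \<Longrightarrow>
     braid_step n (u @ [(i, True), (Suc i, True), (i, True)] @ v)
                  (u @ [(Suc i, True), (i, True), (Suc i, True)] @ v)"

definition braid_eq :: "nat \<Rightarrow> bword \<Rightarrow> bword \<Rightarrow> bool" where
  "braid_eq n = (sup (braid_step n) (conversep (braid_step n)))\<^sup>*\<^sup>*"

definition shift :: "nat \<Rightarrow> bword \<Rightarrow> bword" where
  "shift m w = map (\<lambda>(i, b). (m + i, b)) w"

definition tau :: "nat \<Rightarrow> nat \<Rightarrow> bword" where
  "tau k j = map (\<lambda>i. (i, True)) (rev [j..<Suc k])"

text \<open>Band generator sigma_(j,k+1) = tau_(k,j) sigma_j tau_(k,j)^(-1).\<close>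

definition band :: "nat \<Rightarrow> nat \<Rightarrow> bword" where
  "band j k = tau k j @ [(j, True)] @ inv_word (tau k j)"

definition strongly_quasipositive :: "nat \<Rightarrow> bword \<Rightarrow> bool" where
  "strongly_quasipositive n w \<longleftrightarrow>
     (\<exists>ps. (\<forall>(j, k) \<in> set ps. 1 \<le> j \<and> j \<le> k \<and> k < n) \<and>
           braid_eq n w (concat (map (\<lambda>(j, k). band j k) ps)))"

end

theory Submission
  imports Defs
begin

text \<open>Let \<open>M\<^sub>N\<close> be the monoid presented by the band generators of \<open>B\<^sub>N\<close> with the relations of
  Birman, Ko and Lee. It embeds into \<open>B\<^sub>N\<close>, and every braid becomes an element of the monoid after
  left multiplication by a suitable monoid element. So if \<open>X\<^sub>1 sh\<^sub>m(X\<^sub>2)\<close> equals a product \<open>Z\<close> of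
  bands, pick \<open>A\<^sub>i X\<^sub>i = P\<^sub>i\<close> with \<open>A\<^sub>i\<close>, \<open>P\<^sub>i\<close> in the monoids for \<open>B\<^sub>m\<close> and \<open>B\<^sub>n\<close>; then
  \<open>A\<^sub>1 sh\<^sub>m(A\<^sub>2) Z = P\<^sub>1 sh\<^sub>m(P\<^sub>2)\<close> already holds in \<open>M\<^sub>m\<^sub>+\<^sub>n\<close>. If one side of a
  defining relation only uses bands inside the two blocks of strings, so does the other, whence \<open>Z\<close> splits as
  \<open>Z\<^sub>1 sh\<^sub>m(Z\<^sub>2)\<close> with \<open>A\<^sub>i Z\<^sub>i = P\<^sub>i\<close>, that is \<open>X\<^sub>i = Z\<^sub>i\<close>.

  For the embedding, the simple elements of \<open>M\<^sub>N\<close> are modelled as noncrossing equivalence relations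
  with the Kreweras complement. The monoid acts on lists of simples by the greedy normal form
  algorithm; the greatest simple \<open>d\<close> acts on normal forms by prepending itself, hence injectively,
  and so the action extends to an action of \<open>B\<^sub>N\<close> on fractions \<open>d\<^sup>-\<^sup>k l\<close>, from which a monoid
  element can be recovered.\<close>

section \<open>Kreweras lattices and greedy normal forms\<close>

text \<open>Read through the order-reversing map \<open>K\<close>, the inequality
  \<open>K_compl\<close> says that \<open>x\<close> lies below the join of \<open>t\<close> and the
  quotient \<open>x \<inter> K t\<close>, so inclusion of simple elements is divisibility.
  \<open>L_compl\<close> is the mirror image and makes this quotient unique.\<close>

locale kreweras =
  fixes S :: "'a set set" and K L :: "'a set \<Rightarrow> 'a set" and e d :: "'a set"
  assumes inter: "s \<in> S \<Longrightarrow> t \<in> S \<Longrightarrow> s \<inter> t \<in> S"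
    and K_in: "s \<in> S \<Longrightarrow> K s \<in> S"
    and L_in: "s \<in> S \<Longrightarrow> L s \<in> S"
    and KL: "s \<in> S \<Longrightarrow> K (L s) = s"
    and LK: "s \<in> S \<Longrightarrow> L (K s) = s"
    and K_anti: "s \<in> S \<Longrightarrow> t \<in> S \<Longrightarrow> s \<subseteq> t \<Longrightarrow> K t \<subseteq> K s"
    and L_anti: "s \<in> S \<Longrightarrow> t \<in> S \<Longrightarrow> s \<subseteq> t \<Longrightarrow> L t \<subseteq> L s"
    and K_compl: "t \<in> S \<Longrightarrow> x \<in> S \<Longrightarrow> t \<subseteq> x \<Longrightarrow> K t \<inter> K (x \<inter> K t) \<subseteq> K x"
    and L_compl: "t \<in> S \<Longrightarrow> x \<in> S \<Longrightarrow> t \<subseteq> x \<Longrightarrow> L t \<inter> L (x \<inter> L t) \<subseteq> L x"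
    and e_in: "e \<in> S" and e_least: "s \<in> S \<Longrightarrow> e \<subseteq> s"
    and d_in: "d \<in> S" and d_greatest: "s \<in> S \<Longrightarrow> s \<subseteq> d"
begin

text \<open>\<open>K s\<close> and \<open>L s\<close> are the right and left complements of \<open>s\<close> in \<open>d\<close>. The operation \<open>mul\<close> is the
  join; it is the product of simple elements only when \<open>t \<subseteq> K s\<close>, and for \<open>c \<subseteq> t\<close> the quotient
  of \<open>t\<close> by \<open>c\<close> is \<open>t \<inter> K c\<close>. Thus \<open>act\<close> moves the greatest possible left factor of \<open>t\<close> into \<open>s\<close>.\<close>

definition mul :: "'a set \<Rightarrow> 'a set \<Rightarrow> 'a set" where
  "mul s t = L (K s \<inter> K t)"

fun act :: "'a set \<Rightarrow> 'a set list \<Rightarrow> 'a set list" where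
  "act s [] = (if s = e then [] else [s])"
| "act s (t # l) = mul s (K s \<inter> t) # act (t \<inter> K (K s \<inter> t)) l"

fun norm :: "'a set list \<Rightarrow> 'a set list" where
  "norm [] = []"
| "norm (t # l) = act t l"

section \<open>Joins, complements and quotients of simple elements\<close>

lemmas closed = inter K_in L_in e_in d_in

lemma mul_in [simp]: "s \<in> S \<Longrightarrow> t \<in> S \<Longrightarrow> mul s t \<in> S"
  by (simp add: mul_def closed)

text \<open>Joins become intersections under the injective map \<open>K\<close>; identities between
  products are therefore checked after applying it.\<close>

lemma K_mul: "s \<in> S \<Longrightarrow> t \<in> S \<Longrightarrow> K (mul s t) = K s \<inter> K t"
  by (simp add: mul_def closed KL)

lemma K_inj: "s \<in> S \<Longrightarrow> t \<in> S \<Longrightarrow> K s = K t \<Longrightarrow> s = t"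
  by (metis LK)

lemma K_subset_iff: "s \<in> S \<Longrightarrow> t \<in> S \<Longrightarrow> K t \<subseteq> K s \<longleftrightarrow> s \<subseteq> t"
  by (metis K_anti L_anti LK K_in)

lemma mul_ub1: "s \<in> S \<Longrightarrow> t \<in> S \<Longrightarrow> s \<subseteq> mul s t"
  by (simp add: K_subset_iff [symmetric] K_mul)

lemma mul_ub2: "s \<in> S \<Longrightarrow> t \<in> S \<Longrightarrow> t \<subseteq> mul s t"
  by (simp add: K_subset_iff [symmetric] K_mul)

lemma mul_least:
  "s \<in> S \<Longrightarrow> t \<in> S \<Longrightarrow> x \<in> S \<Longrightarrow> s \<subseteq> x \<Longrightarrow> t \<subseteq> x \<Longrightarrow> mul s t \<subseteq> x"
  by (subst K_subset_iff [symmetric]) (simp_all add: K_mul K_anti)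

lemma mul_assoc:
  "s \<in> S \<Longrightarrow> t \<in> S \<Longrightarrow> u \<in> S \<Longrightarrow> mul (mul s t) u = mul s (mul t u)"
  by (rule K_inj) (auto simp: K_mul)

lemma mul_compl:
  assumes "t \<in> S" "x \<in> S" "t \<subseteq> x"
  shows "mul t (x \<inter> K t) = x"
proof (rule K_inj)
  have "K x \<subseteq> K t \<inter> K (x \<inter> K t)"
    using assms by (simp add: K_anti closed)
  with K_compl [OF assms] show "K (mul t (x \<inter> K t)) = K x"
    using assms by (simp add: K_mul closed)
qed (use assms in \<open>simp_all add: closed\<close>)

text \<open>Uniqueness of the quotient. It is \<open>L_compl\<close> for the pair
  \<open>K (K t) \<subseteq> K w\<close>, whose members are sent by \<open>L\<close> to
  \<open>K t\<close> and \<open>w\<close>.\<close>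

lemma compl_mul:
  assumes "t \<in> S" "w \<in> S" "w \<subseteq> K t"
  shows "mul t w \<inter> K t = w"
proof
  have "K (K t) \<subseteq> K w"
    using assms by (simp add: K_anti closed)
  then have "L (K (K t)) \<inter> L (K w \<inter> L (K (K t))) \<subseteq> L (K w)"
    using assms by (intro L_compl) (simp_all add: closed)
  then show "mul t w \<inter> K t \<subseteq> w"
    using assms by (simp add: LK closed mul_def Int_commute)
  show "w \<subseteq> mul t w \<inter> K t"
    using assms mul_ub2 by auto
qed

lemma K_e: "K e = d"
proof
  show "K e \<subseteq> d" by (simp add: d_greatest closed)
  show "d \<subseteq> K e"
    using K_anti [of e "L d"] by (simp add: closed e_least KL)
qed

lemma K_d: "K d = e"
proof
  show "e \<subseteq> K d" by (simp add: e_least closed)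
  show "K d \<subseteq> e"
    using K_anti [of "L e" d] by (simp add: closed d_greatest KL)
qed

lemma mul_e_left [simp]: "s \<in> S \<Longrightarrow> mul e s = s"
  using d_greatest [of "K s"] by - (rule K_inj, auto simp: K_mul K_e closed)

lemma mul_e_right [simp]: "s \<in> S \<Longrightarrow> mul s e = s"
  using d_greatest [of "K s"] by - (rule K_inj, auto simp: K_mul K_e closed)

lemma inter_K_self: "s \<in> S \<Longrightarrow> s \<inter> K s = e"
  using compl_mul [of s e] by (simp add: closed e_least)

lemma mul_eq_e: "s \<in> S \<Longrightarrow> t \<in> S \<Longrightarrow> mul s t = e \<Longrightarrow> s = e \<and> t = e"
  using mul_ub1 [of s t] mul_ub2 [of s t] e_least by auto

text \<open>Multiplying on the left by \<open>c\<close> turns the product of the two quotients into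
  \<open>u\<close>, and \<open>compl_mul\<close> cancels \<open>c\<close> again. In
  \<open>act_mul\<close> this merges the two remainders that are passed down the list.\<close>

lemma mul_compl_compl:
  assumes "c \<in> S" "w \<in> S" "u \<in> S" "c \<subseteq> w" "w \<subseteq> u"
  shows "mul (w \<inter> K c) (u \<inter> K w) = u \<inter> K c" and "u \<inter> K w \<subseteq> K (w \<inter> K c)"
proof -
  have Kw: "K w = K c \<inter> K (w \<inter> K c)"
    using mul_compl [of c w] K_mul [of c "w \<inter> K c"] assms by (simp add: closed)
  then show "u \<inter> K w \<subseteq> K (w \<inter> K c)" by auto
  let ?p = "w \<inter> K c" and ?q = "u \<inter> K w"
  have "mul c (mul ?p ?q) = mul (mul c ?p) ?q"
    using assms by (simp add: mul_assoc closed)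
  also have "\<dots> = u"
    using assms by (simp add: mul_compl)
  finally have u: "mul c (mul ?p ?q) = u" .
  have "mul ?p ?q \<subseteq> K c"
    using assms Kw by (intro mul_least) (auto simp: closed)
  then show "mul ?p ?q = u \<inter> K c"
    using compl_mul [of c "mul ?p ?q"] u assms by (simp add: closed)
qed

section \<open>The greedy action and its normal forms\<close>

lemma act_in: "s \<in> S \<Longrightarrow> set l \<subseteq> S \<Longrightarrow> set (act s l) \<subseteq> S"
  by (induction l arbitrary: s) (auto simp: closed)

lemma act_e: "set l \<subseteq> S \<Longrightarrow> act e l = l"
proof (induction l)
  case (Cons t l)
  then have "d \<inter> t = t" using d_greatest by auto
  with Cons show ?case by (simp add: K_e inter_K_self)
qed simp

text \<open>Associativity of the action on simple factors. Pushing \<open>t\<close> and then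
  \<open>s\<close> into the list builds the same head as pushing their product at once, and the two
  remainders multiply to the same quotient of \<open>u\<close>, so the induction can pass to the
  tail.\<close>

lemma act_mul:
  assumes "s \<in> S" "t \<in> S" "t \<subseteq> K s" "set l \<subseteq> S"
  shows "act s (act t l) = act (mul s t) l"
  using assms
proof (induction l arbitrary: s t)
  case Nil
  show ?case
  proof (cases "t = e")
    case False
    then have "mul s t \<noteq> e" using mul_eq_e Nil by blast
    moreover have "K s \<inter> t = t" using Nil by auto
    ultimately show ?thesis using False Nil by (simp add: inter_K_self)
  qed (use Nil in simp)
next
  case (Cons u l)
  define w where "w = K t \<inter> u"
  define c where "c = K s \<inter> w"
  define t' where "t' = mul t w"
  define q where "q = u \<inter> K w"
  have S: "s \<in> S" "t \<in> S" "u \<in> S" "w \<in> S" "c \<in> S" "t' \<in> S" "q \<in> S"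
    using Cons.prems by (auto simp: w_def c_def t'_def q_def closed)
  have sub: "c \<subseteq> w" "w \<subseteq> u" "w \<subseteq> K t" "t \<subseteq> K s"
    using Cons.prems by (auto simp: w_def c_def)
  have t'K: "t' \<inter> K t = w"
    using compl_mul S sub by (simp add: t'_def)
  have "t \<subseteq> K s \<inter> t'"
    using mul_ub1 [of t w] S sub by (auto simp: t'_def)
  then have "mul t ((K s \<inter> t') \<inter> K t) = K s \<inter> t'"
    using S by (intro mul_compl) (auto simp: closed)
  \<comment> \<open>From the new head \<open>t'\<close> the element \<open>s\<close> absorbs all of
    \<open>t\<close> together with the part \<open>c\<close> of \<open>w\<close>; what remains is
    the quotient of \<open>w\<close> by \<open>c\<close>.\<close>
  then have i: "K s \<inter> t' = mul t c"
    using t'K by (simp add: c_def Int_assoc)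
  have ii: "t' \<inter> K (K s \<inter> t') = w \<inter> K c"
    using t'K S by (auto simp: i K_mul)
  have c': "K (mul s t) \<inter> u = c"
    using S by (auto simp: K_mul c_def w_def)
  have "act s (act t (u # l)) = mul s (mul t c) # act (w \<inter> K c) (act q l)"
    by (simp add: w_def [symmetric] t'_def [symmetric] ii) (simp add: i q_def)
  also have "act (w \<inter> K c) (act q l) = act (mul (w \<inter> K c) q) l"
    using Cons.prems S sub mul_compl_compl(2) [of c w u]
    by (intro Cons.IH) (auto simp: q_def closed)
  also have "mul (w \<inter> K c) q = u \<inter> K c"
    using mul_compl_compl(1) [of c w u] S sub by (simp add: q_def)
  also have "mul s (mul t c) = mul (mul s t) c"
    using S by (simp add: mul_assoc)
  finally show ?case by (simp add: c')
qed

text \<open>The head of \<open>l\<close> is the product of \<open>c\<close> and its quotient by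
  \<open>c\<close>. Two uses of \<open>act_mul\<close> reassemble the factors that
  \<open>act\<close> has separated. Hence acting preserves normal forms.\<close>

lemma norm_act:
  assumes "s \<in> S" "set l \<subseteq> S"
  shows "norm (act s l) = act s (norm l)"
proof (cases l)
  case (Cons t l')
  define c where "c = K s \<inter> t"
  have S: "t \<in> S" "set l' \<subseteq> S" "c \<in> S" using assms Cons by (auto simp: c_def closed)
  have "norm (act s l) = act (mul s c) (act (t \<inter> K c) l')"
    by (simp add: Cons c_def)
  also have "\<dots> = act s (act c (act (t \<inter> K c) l'))"
    using S assms by (intro act_mul [symmetric] act_in) (auto simp: c_def closed)
  also have "act c (act (t \<inter> K c) l') = act (mul c (t \<inter> K c)) l'"
    using S by (intro act_mul) (auto simp: closed)
  also have "mul c (t \<inter> K c) = t"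
    using S by (intro mul_compl) (auto simp: c_def)
  finally show ?thesis by (simp add: Cons)
qed (use assms in simp)

text \<open>Being fixed by \<open>norm\<close> encodes the greedy condition that nothing nontrivial
  can be moved from an entry into the one before it; it also excludes trailing identities.\<close>

definition nf :: "'a set list set" where
  "nf = {l. set l \<subseteq> S \<and> norm l = l}"

lemma Nil_nf: "[] \<in> nf"
  by (simp add: nf_def)

lemma act_nf: "s \<in> S \<Longrightarrow> l \<in> nf \<Longrightarrow> act s l \<in> nf"
  by (simp add: nf_def act_in norm_act)

text \<open>As \<open>K d = e\<close>, nothing can be moved into \<open>d\<close>, which is simply
  put in front. The case \<open>d = e\<close> is that of at most one string in the instance
  below.\<close>

lemma act_d:
  assumes "l \<in> nf"
  shows "act d l = (if d = e then l else d # l)"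
proof (cases "d = e")
  case True
  then show ?thesis using assms by (simp add: nf_def act_e)
next
  case False
  have "act d l = d # norm l"
  proof (cases l)
    case (Cons t l')
    then have t: "t \<in> S" using assms by (auto simp: nf_def)
    then have "e \<inter> t = e" "t \<inter> d = t" using e_least d_greatest by auto
    then show ?thesis using Cons t by (simp add: K_d K_e d_in)
  qed (use False in simp)
  with False assms show ?thesis by (simp add: nf_def)
qed

lemma act_d_inj: "l \<in> nf \<Longrightarrow> l' \<in> nf \<Longrightarrow> act d l = act d l' \<Longrightarrow> l = l'"
  by (simp add: act_d split: if_splits)

section \<open>Conjugation by the greatest simple element\<close>

lemma L_mul: "s \<in> S \<Longrightarrow> mul (L s) s = d"
  by (rule K_inj) (simp_all add: K_mul closed KL K_d inter_K_self)

lemma mul_K: "s \<in> S \<Longrightarrow> mul s (K s) = d"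
  using L_mul [of "K s"] by (simp add: closed LK)

text \<open>This is conjugation by \<open>d\<close>: from d = (L s) s and d = (L (L s)) (L s) one
  gets d s = (rot s) d.\<close>

definition rot :: "'a set \<Rightarrow> 'a set" where
  "rot s = L (L s)"

lemma rot_in: "s \<in> S \<Longrightarrow> rot s \<in> S"
  by (simp add: rot_def closed)

lemma rot_mono: "s \<in> S \<Longrightarrow> t \<in> S \<Longrightarrow> s \<subseteq> t \<Longrightarrow> rot s \<subseteq> rot t"
  by (simp add: rot_def closed L_anti)

lemma K_rot: "s \<in> S \<Longrightarrow> K (rot s) = rot (K s)"
  by (simp add: rot_def KL LK closed)

text \<open>One inclusion is monotonicity of \<open>rot\<close>; the other applies the monotone
  inverse of \<open>rot\<close>, which is \<open>K\<close> composed with itself.\<close>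

lemma rot_inter:
  assumes "s \<in> S" "t \<in> S"
  shows "rot (s \<inter> t) = rot s \<inter> rot t"
proof
  show "rot (s \<inter> t) \<subseteq> rot s \<inter> rot t"
    using assms by (simp add: rot_mono closed)
  define x where "x = rot s \<inter> rot t"
  have x: "x \<in> S" using assms by (simp add: x_def rot_in closed)
  have "K (K x) \<subseteq> K (K (rot r))" if "r \<in> S" "x \<subseteq> rot r" for r
    using x that by (simp add: K_anti closed rot_in)
  then have "K (K x) \<subseteq> K (K (rot s)) \<inter> K (K (rot t))"
    using assms by (simp add: x_def)
  then have "K (K x) \<subseteq> s \<inter> t"
    using assms by (simp add: rot_def KL closed)
  then have "rot (K (K x)) \<subseteq> rot (s \<inter> t)"
    using x assms by (intro rot_mono) (simp_all add: closed)
  then show "rot s \<inter> rot t \<subseteq> rot (s \<inter> t)"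
    using x by (simp add: rot_def LK closed x_def)
qed

lemma rot_mul: "s \<in> S \<Longrightarrow> t \<in> S \<Longrightarrow> rot (mul s t) = mul (rot s) (rot t)"
  by (rule K_inj) (simp_all add: rot_in K_rot K_mul rot_inter closed)

lemma rot_d: "rot d = d"
  by (metis K_d K_e LK d_in e_in rot_def)

lemma act_d_act:
  assumes "s \<in> S" "set l \<subseteq> S"
  shows "act d (act s l) = act (rot s) (act d l)"
proof -
  have "act d (act s l) = act (mul (rot s) (L s)) (act s l)"
    using assms by (simp add: rot_def L_mul closed)
  also have "\<dots> = act (rot s) (act (L s) (act s l))"
    using assms by (subst act_mul) (simp_all add: rot_def KL closed act_in)
  also have "act (L s) (act s l) = act d l"
    using assms by (subst act_mul) (simp_all add: KL closed L_mul)
  finally show ?thesis .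
qed

abbreviation rotk :: "nat \<Rightarrow> 'a set \<Rightarrow> 'a set" where "rotk k \<equiv> rot ^^ k"
abbreviation actd :: "nat \<Rightarrow> 'a set list \<Rightarrow> 'a set list" where "actd k \<equiv> act d ^^ k"

lemma rotk_in: "s \<in> S \<Longrightarrow> rotk k s \<in> S"
  by (induction k) (simp_all add: rot_in)

lemma rotk_mono: "s \<in> S \<Longrightarrow> t \<in> S \<Longrightarrow> s \<subseteq> t \<Longrightarrow> rotk k s \<subseteq> rotk k t"
  by (induction k) (simp_all add: rot_mono rotk_in)

lemma K_rotk: "s \<in> S \<Longrightarrow> K (rotk k s) = rotk k (K s)"
  by (induction k) (simp_all add: K_rot rotk_in)

lemma rotk_mul: "s \<in> S \<Longrightarrow> t \<in> S \<Longrightarrow> rotk k (mul s t) = mul (rotk k s) (rotk k t)"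
  by (induction k) (simp_all add: rot_mul rotk_in)

lemma rotk_d: "rotk k d = d"
  by (induction k) (simp_all add: rot_d)

lemma actd_nf: "l \<in> nf \<Longrightarrow> actd k l \<in> nf"
  by (induction k) (simp_all add: act_nf d_in)

lemma actd_act: "s \<in> S \<Longrightarrow> l \<in> nf \<Longrightarrow> actd k (act s l) = act (rotk k s) (actd k l)"
proof (induction k)
  case (Suc k)
  have "set (actd k l) \<subseteq> S" using actd_nf [OF Suc.prems(2)] by (simp add: nf_def)
  with Suc show ?case by (simp add: act_d_act rotk_in)
qed simp

lemma actd_inj: "l \<in> nf \<Longrightarrow> l' \<in> nf \<Longrightarrow> actd k l = actd k l' \<Longrightarrow> l = l'"
proof (induction k)
  case (Suc k)
  then have "actd k l = actd k l'" using act_d_inj actd_nf by simp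
  with Suc show ?case by blast
qed simp

section \<open>Fractions whose denominators are powers of the greatest simple element\<close>

text \<open>A pair \<open>(k, l)\<close> stands for the fraction \<open>d\<^sup>-\<^sup>k l\<close>.\<close>

definition eqv :: "nat \<times> 'a set list \<Rightarrow> nat \<times> 'a set list \<Rightarrow> bool" where
  "eqv x y \<longleftrightarrow> actd (fst y) (snd x) = actd (fst x) (snd y)"

text \<open>Moving \<open>s\<close> past the denominator gives s d^-k = d^-k (rot^k s).\<close>

definition pos :: "'a set \<Rightarrow> nat \<times> 'a set list \<Rightarrow> nat \<times> 'a set list" where
  "pos s x = (fst x, act (rotk (fst x) s) (snd x))"

text \<open>Since s (K s) = d, the inverse of \<open>s\<close> is (K s) d^-1. Moving
  \<open>K s\<close> past the enlarged denominator applies \<open>rot\<close> once more than in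
  \<open>pos\<close>.\<close>

definition neg :: "'a set \<Rightarrow> nat \<times> 'a set list \<Rightarrow> nat \<times> 'a set list" where
  "neg s x = (Suc (fst x), act (rotk (Suc (fst x)) (K s)) (snd x))"

abbreviation fractions :: "(nat \<times> 'a set list) set" where "fractions \<equiv> UNIV \<times> nf"

lemma pos_in: "s \<in> S \<Longrightarrow> x \<in> fractions \<Longrightarrow> pos s x \<in> fractions"
  by (auto simp: pos_def act_nf rotk_in)

lemma neg_in: "s \<in> S \<Longrightarrow> x \<in> fractions \<Longrightarrow> neg s x \<in> fractions"
  unfolding neg_def by (auto simp del: funpow.simps intro!: act_nf rotk_in K_in)

lemma eqv_refl [simp]: "eqv x x"
  by (simp add: eqv_def)

lemma eqv_sym: "eqv x y \<Longrightarrow> eqv y x"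
  by (simp add: eqv_def)

lemma actd_actd: "actd i (actd j l) = actd j (actd i l)"
  by (metis add.commute comp_apply funpow_add)

text \<open>The middle denominator has to be cancelled, and here the injectivity of
  \<open>act d\<close> on normal forms enters.\<close>

lemma eqv_trans:
  assumes "eqv x y" "eqv y z" "x \<in> fractions" "y \<in> fractions" "z \<in> fractions"
  shows "eqv x z"
proof -
  have "actd (fst y) (actd (fst z) (snd x)) = actd (fst y) (actd (fst x) (snd z))"
    using assms(1,2) unfolding eqv_def by (metis actd_actd)
  then show ?thesis
    using assms unfolding eqv_def by (auto intro!: actd_inj [of _ _ "fst y"] actd_nf)
qed

lemma pos_cong:
  assumes "s \<in> S" "x \<in> fractions" "y \<in> fractions" "eqv x y"
  shows "eqv (pos s x) (pos s y)"
  using assms unfolding eqv_def pos_def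
  by (auto simp: actd_act rotk_in simp flip: funpow_add comp_apply [of "rotk _" "rotk _"])
     (simp add: add.commute)

lemma neg_cong:
  assumes "s \<in> S" "x \<in> fractions" "y \<in> fractions" "eqv x y"
  shows "eqv (neg s x) (neg s y)"
proof -
  have "actd (Suc k') (act (rotk (Suc k) (K s)) l) = actd (Suc k) (act (rotk (Suc k') (K s)) l')"
    if "actd k' l = actd k l'" "l \<in> nf" "l' \<in> nf" for k k' l l'
  proof -
    have *: "actd (Suc i) (act (rotk (Suc j) (K s)) h) = act (rotk (Suc i + Suc j) (K s)) (act d (actd i h))"
      if "h \<in> nf" for i j h
      using actd_act [of "rotk (Suc j) (K s)" h "Suc i"] rotk_in [of "K s" "Suc j"] that assms
        funpow_add [of "Suc i" "Suc j" rot]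
      by (simp del: funpow.simps add: K_in) simp
    show ?thesis using that by (simp only: * add.commute)
  qed
  with assms show ?thesis unfolding eqv_def neg_def by (auto simp del: funpow.simps)
qed

lemma pos_mul:
  assumes "s \<in> S" "t \<in> S" "t \<subseteq> K s" "x \<in> fractions"
  shows "pos s (pos t x) = pos (mul s t) x"
proof -
  have "rotk (fst x) t \<subseteq> K (rotk (fst x) s)"
    using assms by (simp add: K_rotk rotk_mono closed)
  with assms show ?thesis
    by (auto simp: pos_def rotk_mul nf_def act_mul rotk_in)
qed

lemma pos_d: "x \<in> fractions \<Longrightarrow> pos d (Suc (fst x), snd x) = (Suc (fst x), act d (snd x))"
  by (simp add: pos_def rotk_d rot_d)

lemma eqv_Suc: "eqv (Suc k, act d l) (k, l)"
  by (simp add: eqv_def funpow_swap1)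

lemma pos_neg: "s \<in> S \<Longrightarrow> x \<in> fractions \<Longrightarrow> eqv (pos s (neg s x)) x"
proof -
  assume s: "s \<in> S" and x: "x \<in> fractions"
  have "pos s (neg s x) = pos s (pos (K s) (Suc (fst x), snd x))"
    by (simp add: pos_def neg_def)
  also have "\<dots> = pos d (Suc (fst x), snd x)"
    using s x by (subst pos_mul) (auto simp: closed mul_K)
  also have "\<dots> = (Suc (fst x), act d (snd x))"
    using x by (rule pos_d)
  finally show ?thesis using eqv_Suc [of "fst x" "snd x"] by simp
qed

lemma neg_pos: "s \<in> S \<Longrightarrow> x \<in> fractions \<Longrightarrow> eqv (neg s (pos s x)) x"
proof -
  assume s: "s \<in> S" and x: "x \<in> fractions"
  \<comment> \<open>The factor supplied by \<open>neg\<close> now stands to the left of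
    \<open>s\<close>, so it must become the left complement.\<close>
  have "rot (K s) = L s" using s by (simp add: rot_def LK)
  then have "neg s (pos s x) = (Suc (fst x), snd (pos (L s) (pos s x)))"
    by (simp add: pos_def neg_def funpow_swap1)
  also have "pos (L s) (pos s x) = pos d x"
    using s x by (subst pos_mul) (auto simp: closed L_mul KL)
  also have "(Suc (fst x), snd (pos d x)) = (Suc (fst x), act d (snd x))"
    by (simp add: pos_def rotk_d)
  finally show ?thesis using eqv_Suc [of "fst x" "snd x"] by simp
qed

end

section \<open>Noncrossing equivalence relations\<close>

text \<open>Place a point \<open>i'\<close> between \<open>i\<close> and \<open>i + 1\<close> on a circle. Then \<open>uncrossed k l i j\<close>
  says that the chord from \<open>k'\<close> to \<open>l'\<close> does not cross the chord from \<open>i\<close> to \<open>j\<close>.\<close>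

definition uncrossed :: "nat \<Rightarrow> nat \<Rightarrow> nat \<Rightarrow> nat \<Rightarrow> bool" where
  "uncrossed k l i j \<longleftrightarrow> ((k < i \<longleftrightarrow> l < i) \<longleftrightarrow> (k < j \<longleftrightarrow> l < j))"

text \<open>The Kreweras complement. \<open>R\<close> relates unprimed points and the result relates
  primed ones, while \<open>krewK\<close> goes the opposite way; both are the polarities of the
  single relation \<open>uncrossed\<close>.\<close>

definition krewL :: "nat \<Rightarrow> (nat \<times> nat) set \<Rightarrow> (nat \<times> nat) set" where
  "krewL N R = {(k, l). k \<in> {0<..N} \<and> l \<in> {0<..N} \<and> (\<forall>(i, j) \<in> R. uncrossed k l i j)}"

definition krewK :: "nat \<Rightarrow> (nat \<times> nat) set \<Rightarrow> (nat \<times> nat) set" where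
  "krewK N R = {(i, j). i \<in> {0<..N} \<and> j \<in> {0<..N} \<and> (\<forall>(k, l) \<in> R. uncrossed k l i j)}"

definition nc :: "nat \<Rightarrow> (nat \<times> nat) set \<Rightarrow> bool" where
  "nc N R \<longleftrightarrow> R \<subseteq> {0<..N} \<times> {0<..N} \<and> (\<forall>i \<in> {0<..N}. (i, i) \<in> R) \<and> sym R \<and> trans R \<and>
     (\<forall>a b c d. a < b \<and> b < c \<and> c < d \<and> (a, c) \<in> R \<and> (b, d) \<in> R \<longrightarrow> (a, b) \<in> R)"

lemma nc_bound: "nc N R \<Longrightarrow> (i, j) \<in> R \<Longrightarrow> i \<in> {0<..N} \<and> j \<in> {0<..N}"
  unfolding nc_def by blast

lemma nc_refl: "nc N R \<Longrightarrow> i \<in> {0<..N} \<Longrightarrow> (i, i) \<in> R"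
  unfolding nc_def by blast

lemma nc_sym: "nc N R \<Longrightarrow> (i, j) \<in> R \<Longrightarrow> (j, i) \<in> R"
  unfolding nc_def by (meson symD)

lemma nc_trans: "nc N R \<Longrightarrow> (i, j) \<in> R \<Longrightarrow> (j, k) \<in> R \<Longrightarrow> (i, k) \<in> R"
  unfolding nc_def by (meson transD)

lemma nc_cross:
  "nc N R \<Longrightarrow> (a, c) \<in> R \<Longrightarrow> (b, d) \<in> R \<Longrightarrow> a < b \<Longrightarrow> b < c \<Longrightarrow> c < d \<Longrightarrow> (a, b) \<in> R"
  unfolding nc_def by blast

text \<open>A chord from i to j cuts the primed points into two arcs, and lying in the same arc is a
  noncrossing equivalence. The complement is the intersection of these equivalences.\<close>

lemma nc_krewL: "nc N (krewL N R)"
proof -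
  have "uncrossed a b i j"
    if "a < b" "b < c" "c < d" "uncrossed a c i j" "uncrossed b d i j" for a b c d i j
  proof -
    \<comment> \<open>The order of the four points enters only through these implications for the
      cuts at \<open>i\<close> and \<open>j\<close>; the rest is propositional.\<close>
    have mono: "(b < m \<longrightarrow> a < m) \<and> (c < m \<longrightarrow> b < m) \<and> (d < m \<longrightarrow> c < m)" for m
      using that by auto
    show ?thesis
      using mono [of i] mono [of j] that(4,5) unfolding uncrossed_def by argo
  qed
  then have "\<forall>a b c d. a < b \<and> b < c \<and> c < d \<and> (a, c) \<in> krewL N R \<and> (b, d) \<in> krewL N R
      \<longrightarrow> (a, b) \<in> krewL N R"
    unfolding krewL_def by fast
  moreover have "sym (krewL N R)" "trans (krewL N R)"
    unfolding krewL_def sym_def trans_def uncrossed_def by fast+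
  moreover have "krewL N R \<subseteq> {0<..N} \<times> {0<..N}" "\<forall>i \<in> {0<..N}. (i, i) \<in> krewL N R"
    by (auto simp: krewL_def uncrossed_def)
  ultimately show ?thesis
    unfolding nc_def by (intro conjI)
qed

section \<open>Reflection of the circle\<close>

definition flip :: "nat \<Rightarrow> (nat \<times> nat) set \<Rightarrow> (nat \<times> nat) set" where
  "flip N R = {(i, j). i \<in> {0<..N} \<and> j \<in> {0<..N} \<and> (Suc N - i, Suc N - j) \<in> R}"

lemma flip_flip:
  assumes "R \<subseteq> {0<..N} \<times> {0<..N}"
  shows "flip N (flip N R) = R"
proof -
  have "(i, j) \<in> flip N (flip N R) \<longleftrightarrow> (i, j) \<in> R" for i j
    using subsetD [OF assms, of "(i, j)"] by (auto simp: flip_def)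
  then show ?thesis by auto
qed

lemma flip_mono: "R \<subseteq> T \<Longrightarrow> flip N R \<subseteq> flip N T"
  by (auto simp: flip_def)

lemma flip_Int: "flip N (R \<inter> T) = flip N R \<inter> flip N T"
  by (auto simp: flip_def)

lemma nc_flip: assumes "nc N R" shows "nc N (flip N R)"
proof -
  have "(Suc N - a, Suc N - b) \<in> R"
    if "a < b" "b < c" "c < d" "d \<in> {0<..N}" "(Suc N - a, Suc N - c) \<in> R" "(Suc N - b, Suc N - d) \<in> R"
    for a b c d
  proof -
    \<comment> \<open>The reflection reverses the order, so noncrossing relates the last two points;
      the first two follow by symmetry and transitivity.\<close>
    have "(Suc N - d, Suc N - c) \<in> R"
      using that by (intro nc_cross [OF assms nc_sym [OF assms that(6)] nc_sym [OF assms that(5)]]) auto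
    then show ?thesis using that assms by (meson nc_sym nc_trans)
  qed
  then have "\<forall>a b c d. a < b \<and> b < c \<and> c < d \<and> (a, c) \<in> flip N R \<and> (b, d) \<in> flip N R
      \<longrightarrow> (a, b) \<in> flip N R"
    unfolding flip_def by blast
  moreover have "sym (flip N R)" "trans (flip N R)"
    using nc_sym [OF assms] nc_trans [OF assms] unfolding flip_def sym_def trans_def by blast+
  moreover have "flip N R \<subseteq> {0<..N} \<times> {0<..N}" "\<forall>i \<in> {0<..N}. (i, i) \<in> flip N R"
    by (auto simp: flip_def intro!: nc_refl [OF assms])
  ultimately show ?thesis
    unfolding nc_def by (intro conjI)
qed

text \<open>The reflection reverses every comparison \<open>k < i\<close>, so primed and unprimed
  points exchange their roles. This transfers all results on \<open>krewL\<close> to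
  \<open>krewK\<close>.\<close>

lemma krewK_flip:
  assumes "R \<subseteq> {0<..N} \<times> {0<..N}"
  shows "krewK N R = flip N (krewL N (flip N R))"
proof -
  have u: "uncrossed k l i j \<longleftrightarrow> uncrossed (Suc N - i) (Suc N - j) (Suc N - k) (Suc N - l)"
    if "i \<le> N" "j \<le> N" "k \<le> N" "l \<le> N" for i j k l
    using that unfolding uncrossed_def by (simp add: diff_less_mono2 less_diff_conv2) linarith
  have "(i, j) \<in> krewK N R \<longleftrightarrow> (i, j) \<in> flip N (krewL N (flip N R))" for i j
  proof (cases "i \<in> {0<..N} \<and> j \<in> {0<..N}")
    case True
    have "(\<forall>(k, l) \<in> R. uncrossed k l i j) \<longleftrightarrow>
        (\<forall>(k, l) \<in> flip N R. uncrossed (Suc N - i) (Suc N - j) k l)"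
    proof safe
      fix k l assume "\<forall>(k, l) \<in> R. uncrossed k l i j" "(k, l) \<in> flip N R"
      then show "uncrossed (Suc N - i) (Suc N - j) k l"
        using u [of i j "Suc N - k" "Suc N - l"] True by (auto simp: flip_def)
    next
      fix k l assume *: "\<forall>(k, l) \<in> flip N R. uncrossed (Suc N - i) (Suc N - j) k l" "(k, l) \<in> R"
      then have "(Suc N - k, Suc N - l) \<in> flip N R" "k \<le> N" "l \<le> N"
        using subsetD [OF assms *(2)] by (auto simp: flip_def)
      with * show "uncrossed k l i j"
        using u [of i j k l] True by auto
    qed
    then show ?thesis using True by (auto simp: krewK_def krewL_def flip_def)
  qed (auto simp: krewK_def flip_def)
  then show ?thesis by auto
qed

lemma nc_subset: "nc N R \<Longrightarrow> R \<subseteq> {0<..N} \<times> {0<..N}"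
  by (simp add: nc_def)

lemma flip_krewK:
  assumes "nc N R" shows "flip N (krewK N R) = krewL N (flip N R)"
  using krewK_flip [of R N] flip_flip [of "krewL N (flip N R)" N] nc_subset assms nc_krewL
  by metis

lemma krewK_flip_eq: "nc N R \<Longrightarrow> krewK N (flip N R) = flip N (krewL N R)"
  by (metis flip_flip krewK_flip nc_flip nc_subset)

lemma nc_krewK: "nc N R \<Longrightarrow> nc N (krewK N R)"
  using nc_flip [OF nc_krewL] krewK_flip [OF nc_subset] by metis

lemma nc_Int:
  assumes "nc N R" "nc N T" shows "nc N (R \<inter> T)"
proof -
  have "\<forall>a b c d. a < b \<and> b < c \<and> c < d \<and> (a, c) \<in> R \<inter> T \<and> (b, d) \<in> R \<inter> T
      \<longrightarrow> (a, b) \<in> R \<inter> T"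
    by (metis IntD1 IntD2 IntI nc_cross [OF assms(1)] nc_cross [OF assms(2)])
  moreover have "sym (R \<inter> T)" "trans (R \<inter> T)"
    using assms by (simp_all add: nc_def sym_Int trans_Int)
  moreover have "R \<inter> T \<subseteq> {0<..N} \<times> {0<..N}" "\<forall>i \<in> {0<..N}. (i, i) \<in> R \<inter> T"
    using nc_refl assms nc_subset by blast+
  ultimately show ?thesis unfolding nc_def by (intro conjI)
qed

section \<open>The two complements are mutually inverse\<close>

lemma galois: 
  assumes "R \<subseteq> {0<..N} \<times> {0<..N}" "T \<subseteq> {0<..N} \<times> {0<..N}"
  shows "T \<subseteq> krewK N R \<longleftrightarrow> R \<subseteq> krewL N T"
  using assms by (fastforce simp: krewK_def krewL_def)

text \<open>By contraposition: points \<open>i < j\<close> in different classes are separated by a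
  chord of the complement. It closes off either the gap of the class of \<open>i\<close> that
  contains \<open>j\<close>, or the whole span of that class.\<close>

lemma krewK_krewL_subset:
  assumes R: "nc N R"
  shows "krewK N (krewL N R) \<subseteq> R"
proof -
  note sym = nc_sym [OF R] and trans = nc_trans [OF R] and cross = nc_cross [OF R]
    and bound = nc_bound [OF R]
  have *: "\<exists>(k, l) \<in> krewL N R. \<not> uncrossed k l i j"
    if "(i, j) \<notin> R" "i < j" "i \<in> {0<..N}" "j \<in> {0<..N}" for i j
  proof -
    have ii: "(i, i) \<in> R" using that nc_refl [OF R] by simp
    obtain b where b: "(i, b) \<in> R" "b < j" and bmax: "\<And>b'. (i, b') \<in> R \<Longrightarrow> b' < j \<Longrightarrow> b' \<le> b"
    proof -
      let ?B = "{b. (i, b) \<in> R \<and> b < j}"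
      have "finite ?B" "?B \<noteq> {}" using ii \<open>i < j\<close> by auto
      then have "Max ?B \<in> ?B" "\<forall>b \<in> ?B. b \<le> Max ?B" using Max_in [of ?B] Max_ge [of ?B] by blast+
      then show thesis using that [of "Max ?B"] by blast
    qed
    have ib: "i \<le> b" using bmax ii that by simp
    have bN: "b \<in> {0<..N}" using bound b by blast
    \<comment> \<open>The unprimed points between k' and l' are k + 1, ..., l. If they form a union
      of classes, no chord of \<open>R\<close> crosses the chord from k' to l'.\<close>
    have satI: "(k, l) \<in> krewL N R"
      if "k < l" "k \<in> {0<..N}" "l \<in> {0<..N}"
        "\<And>f g. (f, g) \<in> R \<Longrightarrow> k < f \<Longrightarrow> f \<le> l \<Longrightarrow> k < g \<and> g \<le> l" for k l
      unfolding krewL_def uncrossed_def using that sym by (auto simp: not_le not_less) (meson leD le_less_linear)+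
    show ?thesis
    proof (cases "\<exists>c > j. (i, c) \<in> R")
      case True
      \<comment> \<open>Now \<open>b\<close> and \<open>c\<close> are the neighbours of
        \<open>j\<close> in the class of \<open>i\<close>. The separating chord ends at
        \<open>c - 1\<close> because that primed point comes just before \<open>c\<close>.\<close>
      define c where "c = (LEAST c. c > j \<and> (i, c) \<in> R)"
      have c: "c > j" "(i, c) \<in> R" using LeastI_ex [of "\<lambda>c. c > j \<and> (i, c) \<in> R"] True
        by (auto simp: c_def)
      have cmin: "c \<le> c'" if "c' > j" "(i, c') \<in> R" for c'
        unfolding c_def using that by (intro Least_le) auto
      have bc: "(b, c) \<in> R" using b c sym trans by blast
      have gap: "(i, f) \<notin> R" if "b < f" "f < c" for f
        using that bmax [of f] cmin [of f] \<open>(i, j) \<notin> R\<close> by (metis leD nat_neq_iff)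
      have gap': "(b, f) \<notin> R" if "b < f" "f < c" for f
        using gap that b trans by blast
      have "(b, c - 1) \<in> krewL N R"
      proof (rule satI)
        fix f g assume fg: "(f, g) \<in> R" "b < f" "f \<le> c - 1"
        then have f: "f < c" using c by simp
        show "b < g \<and> g \<le> c - 1"
        proof (rule ccontr)
          assume "\<not> (b < g \<and> g \<le> c - 1)"
          then consider "g = b" | "g < b" | "g = c" | "g > c" by linarith
          then show False
          proof cases
            case 1 then show False using fg gap' f sym by blast
          next
            case 2 then show False
              using cross [of g f b c] fg f bc sym gap' trans by blast
          next
            case 3 then show False using fg bc gap' f sym trans by blast
          next
            case 4 then show False
              using cross [of b c f g] fg f bc gap' by blast
          qed
        qed
      qed (use b c bN bound [OF c(2)] in auto)
      moreover have "\<not> uncrossed b (c - 1) i j"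
        using ib b c unfolding uncrossed_def by auto
      ultimately show ?thesis by blast
    next
      case False
      \<comment> \<open>The class of \<open>i\<close> lies below \<open>j\<close>, with least
        element \<open>a\<close> and greatest element \<open>b\<close>; the chord must enclose all
        of it.\<close>
      define a where "a = (LEAST a. (i, a) \<in> R)"
      have a: "(i, a) \<in> R" using LeastI [of "\<lambda>c. (i, c) \<in> R"] ii by (simp add: a_def)
      have amin: "a \<le> a'" if "(i, a') \<in> R" for a'
        unfolding a_def using that by (rule Least_le)
      have aN: "a \<in> {0<..N}" using bound a by blast
      have bmax': "b' \<le> b" if "(i, b') \<in> R" for b'
        using bmax [of b'] False that \<open>(i, j) \<notin> R\<close> by (metis nat_neq_iff)
      have ab: "(a, b) \<in> R" using a b sym trans by blast
      have out: "(f, g) \<notin> R" if "a \<le> f" "f \<le> b" "g < a \<or> b < g" for f g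
      proof
        assume fg: "(f, g) \<in> R"
        have "(i, f) \<notin> R" using trans [OF _ fg, of i] amin [of g] bmax' [of g] that(3) by linarith
        then have "(a, f) \<notin> R" "(b, f) \<notin> R" using a b trans by blast+
        then have "f \<noteq> a" "f \<noteq> b" using ab sym trans by blast+
        then have "a < f" "f < b" using that by auto
        then show False
          using that(3) cross [of a b f g] cross [of g f a b] ab fg sym trans \<open>(a, f) \<notin> R\<close> by blast
      qed
      show ?thesis
      proof (cases "a = 1")
        case True
        \<comment> \<open>On the circle the primed point just before 1 is N'.\<close>
        have "(b, N) \<in> krewL N R"
        proof (rule satI)
          fix f g assume fg: "(f, g) \<in> R" "b < f" "f \<le> N"
          then show "b < g \<and> g \<le> N"
            using out [of g f] True sym [OF fg(1)] bound [OF fg(1)] by (cases "g \<le> b") auto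
        qed (use b bN that in auto)
        moreover have "\<not> uncrossed b N i j"
          using ib b that unfolding uncrossed_def by auto
        ultimately show ?thesis by blast
      next
        case False
        then have a2: "a - 1 < a" "1 \<le> a - 1" using aN by auto
        have "(a - 1, b) \<in> krewL N R"
        proof (rule satI)
          fix f g assume "(f, g) \<in> R" "a - 1 < f" "f \<le> b"
          then show "a - 1 < g \<and> g \<le> b"
            using out [of f g] a2 by (cases "g < a \<or> b < g") auto
        qed (use a2 bN aN ib amin [OF ii] in auto)
        moreover have "\<not> uncrossed (a - 1) b i j"
          using ib b amin [OF ii] a2 unfolding uncrossed_def by auto
        ultimately show ?thesis by blast
      qed
    qed
  qed
  show ?thesis
  proof clarify
    fix i j assume ij: "(i, j) \<in> krewK N (krewL N R)"
    then have ji: "(j, i) \<in> krewK N (krewL N R)" and N: "i \<in> {0<..N}" "j \<in> {0<..N}"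
      by (auto simp: krewK_def uncrossed_def)
    consider "i < j" | "i = j" | "j < i" by linarith
    then show "(i, j) \<in> R"
    proof cases
      case 1 then show ?thesis using * [of i j] ij N by (auto simp: krewK_def)
    next
      case 2 then show ?thesis using nc_refl [OF R] N by simp
    next
      case 3 then show ?thesis using * [of j i] ji N by - (rule sym, auto simp: krewK_def)
    qed
  qed
qed

lemma krewK_krewL:
  assumes "nc N R" shows "krewK N (krewL N R) = R"
  using krewK_krewL_subset [OF assms] galois [of "krewL N R" N R] assms nc_subset nc_krewL by blast

lemma krewL_krewK: "nc N R \<Longrightarrow> krewL N (krewK N R) = R"
  by (metis flip_flip flip_krewK krewK_krewL nc_flip nc_krewL nc_subset krewK_flip_eq nc_krewK)

section \<open>The quotient inequalities for noncrossing relations\<close>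

lemma adjacent_pair:
  assumes R: "nc N R"
  shows "(i, j) \<in> R \<Longrightarrow> i < j \<Longrightarrow> Q i \<noteq> Q j \<Longrightarrow>
    \<exists>b c. (b, c) \<in> R \<and> b < c \<and> Q b \<noteq> Q c \<and> (\<forall>m. b < m \<and> m < c \<longrightarrow> (b, m) \<notin> R)"
proof (induction "j - i" arbitrary: i j rule: less_induct)
  case less
  show ?case
  proof (cases "\<exists>m. i < m \<and> m < j \<and> (i, m) \<in> R")
    case True
    then obtain m where m: "i < m" "m < j" "(i, m) \<in> R" by blast
    then have mj: "(m, j) \<in> R" using less.prems nc_sym [OF R] nc_trans [OF R] by blast
    show ?thesis
    proof (cases "Q i = Q m")
      case True then show ?thesis using less.hyps [of j m] less.prems m mj by auto
    next
      case False then show ?thesis using less.hyps [of m i] less.prems m mj by auto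
    qed
  qed (use less.prems in blast)
qed

text \<open>A chord in both complements on the left has each class of \<open>t\<close>, and each
  pair in \<open>x \<inter> krewL N t\<close>, on one side. Neighbours \<open>b < c\<close> of an
  \<open>x\<close>-class are linked by such pairs through \<open>p\<close>, the cyclic predecessor
  of \<open>c\<close> in its \<open>t\<close>-class, so they lie on the same side too.\<close>

lemma krewL_compl:
  assumes t: "nc N t" and x: "nc N x" and tx: "t \<subseteq> x"
  shows "krewL N t \<inter> krewL N (x \<inter> krewL N t) \<subseteq> krewL N x"
proof clarify
  fix k l assume kl: "(k, l) \<in> krewL N t" "(k, l) \<in> krewL N (x \<inter> krewL N t)"
  note tsym = nc_sym [OF t] and ttrans = nc_trans [OF t] and tcross = nc_cross [OF t]
  note xsym = nc_sym [OF x] and xtrans = nc_trans [OF x] and xcross = nc_cross [OF x]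
  \<comment> \<open>\<open>Q m\<close> records the side of the chord from k' to l' on which
    \<open>m\<close> lies.\<close>
  define Q where "Q m \<longleftrightarrow> (k < m \<longleftrightarrow> l < m)" for m
  have Qt: "Q i = Q j" if "(i, j) \<in> t" for i j
    using kl(1) that by (auto simp: krewL_def uncrossed_def Q_def)
  have Qx: "Q i = Q j" if "(i, j) \<in> x" "(i, j) \<in> krewL N t" for i j
    using kl(2) that unfolding krewL_def [of N "x \<inter> _"] uncrossed_def Q_def by blast
  have step: "Q i = Q j" if ij: "(i, j) \<in> x" "i < j" for i j
  proof (rule ccontr)
    assume "Q i \<noteq> Q j"
    then obtain b c where bc: "(b, c) \<in> x" "b < c" "Q b \<noteq> Q c"
      and gap: "\<And>m. b < m \<Longrightarrow> m < c \<Longrightarrow> (b, m) \<notin> x"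
      using adjacent_pair [OF x ij, of Q] by blast
    have N: "b \<in> {0<..N}" "c \<in> {0<..N}" using nc_bound [OF x bc(1)] by auto
    \<comment> \<open>Read as primed points, \<open>b\<close> and \<open>p\<close> enclose the
      points from the minimum plus 1 up to the maximum; these have to form a union of
      \<open>t\<close>-classes.\<close>
    have satI: "(b, p) \<in> krewL N t \<and> (p, b) \<in> krewL N t"
      if "p \<in> {0<..N}" "\<And>f g. (f, g) \<in> t \<Longrightarrow> min b p < f \<Longrightarrow> f \<le> max b p \<Longrightarrow> min b p < g \<and> g \<le> max b p" for p
    proof -
      have "uncrossed b p f g" if "(f, g) \<in> t" for f g
        using \<open>\<And>f g. (f, g) \<in> t \<Longrightarrow> min b p < f \<Longrightarrow> f \<le> max b p \<Longrightarrow> min b p < g \<and> g \<le> max b p\<close>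
          [of f g] \<open>\<And>f g. (f, g) \<in> t \<Longrightarrow> min b p < f \<Longrightarrow> f \<le> max b p \<Longrightarrow> min b p < g \<and> g \<le> max b p\<close>
          [of g f] that tsym [of f g] unfolding uncrossed_def by linarith
      then show ?thesis using N that(1) by (auto simp: krewL_def uncrossed_def)
    qed
    have "\<exists>p. (p, c) \<in> t \<and> (b, p) \<in> krewL N t"
    proof (cases "\<exists>p < c. (p, c) \<in> t")
      case True
      let ?A = "{p. p < c \<and> (p, c) \<in> t}"
      define p where "p = Max ?A"
      have "finite ?A" "?A \<noteq> {}" using True by auto
      then have p: "p < c" "(p, c) \<in> t" and pmax: "\<And>q. q < c \<Longrightarrow> (q, c) \<in> t \<Longrightarrow> q \<le> p"
        using Max_in [of ?A] Max_ge [of ?A] by (auto simp: p_def)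
      \<comment> \<open>As \<open>p\<close> is \<open>x\<close>-related to \<open>b\<close>, it
        cannot lie in the gap between \<open>b\<close> and \<open>c\<close>.\<close>
      have pb: "p \<le> b"
        using gap [of p] p tx bc xsym xtrans by (meson not_le subsetD)
      have "(b, p) \<in> krewL N t"
      proof (rule conjunct1 [OF satI])
        fix f g assume fg: "(f, g) \<in> t" "min b p < f" "f \<le> max b p"
        then have f: "p < f" "f \<le> b" using pb by auto
        then have fc: "(f, c) \<notin> t" using pmax [of f] bc by auto
        have fgx: "(f, g) \<in> x" using fg tx by blast
        show "min b p < g \<and> g \<le> max b p"
        proof (rule ccontr)
          assume "\<not> (min b p < g \<and> g \<le> max b p)"
          then consider "g > c" | "g = c" | "b < g" "g < c" | "g = p" | "g < p" using pb by linarith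
          then show False
          proof cases
            case 1 then show False
              using tcross [of p c f g] p f fg fc bc tsym ttrans by (meson le_less_trans)
          next
            case 2 then show False using fg fc by simp
          next
            case 3 then show False
              using xcross [of f g b c] fgx f bc gap xsym xtrans by (metis le_less)
          next
            case 4 then show False using fg fc p ttrans by blast
          next
            case 5 then show False
              using tcross [of g f p c] p f fg fc bc tsym ttrans by (meson le_less_trans)
          qed
        qed
      qed (use nc_bound [OF t p(2)] in simp)
      then show ?thesis using p by blast
    next
      case False
      let ?A = "{p. (p, c) \<in> t}"
      \<comment> \<open>Here \<open>c\<close> is least in its \<open>t\<close>-class, so its cyclic
        predecessor is the greatest element.\<close>
      define p where "p = Max ?A"
      have "?A \<subseteq> {0<..N}" using nc_bound [OF t] by blast
      then have "finite ?A" using finite_subset by blast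
      moreover have "?A \<noteq> {}" using nc_refl [OF t N(2)] by auto
      ultimately have p: "(p, c) \<in> t" and pmax: "\<And>q. (q, c) \<in> t \<Longrightarrow> q \<le> p"
        using Max_in [of ?A] Max_ge [of ?A] by (auto simp: p_def)
      have pc: "c \<le> p" using pmax nc_refl [OF t N(2)] by simp
      have cp: "(c, p) \<in> t" using p tsym by blast
      have no: "(q, c) \<notin> t" if "q < c \<or> q > p" for q
        using that False pmax [of q] by auto
      have "(b, p) \<in> krewL N t"
      proof (rule conjunct1 [OF satI])
        fix f g assume fg: "(f, g) \<in> t" "min b p < f" "f \<le> max b p"
        then have f: "b < f" "f \<le> p" using pc bc by auto
        have fgx: "(f, g) \<in> x" using fg tx by blast
        show "min b p < g \<and> g \<le> max b p"
        proof (rule ccontr)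
          assume "\<not> (min b p < g \<and> g \<le> max b p)"
          then have g: "g > p \<or> g \<le> b" using pc bc by linarith
          then have gc: "(g, c) \<notin> t" using no [of g] bc by auto
          have fc: "(f, c) \<notin> t" using gc fg tsym ttrans by blast
          then have "f \<noteq> c" "f \<noteq> p" using nc_refl [OF t N(2)] p by auto
          then consider "f < c" "g > p" | "f < c" "g = b" | "f < c" "g < b"
            | "c < f" "f < p" "g > p" | "c < f" "f < p" "g \<le> b"
            using f g by linarith
          then show False
          proof cases
            case 1 then show False using xcross [of b c f g] bc fgx f gap pc by (meson le_less_trans)
          next
            case 2 then show False using fgx f gap xsym by blast
          next
            case 3 then show False
              using xcross [of g f b c] bc fgx f gap xsym xtrans by blast
          next
            case 4 then show False using tcross [of c p f g] cp fg fc tsym by blast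
          next
            case 5 then show False
              using tcross [of g f c p] cp fg gc bc tsym by (meson le_less_trans)
          qed
        qed
      qed (use nc_bound [OF t p] in simp)
      then show ?thesis using p by blast
    qed
    then obtain p where p: "(p, c) \<in> t" "(b, p) \<in> krewL N t" by blast
    then have "(b, p) \<in> x" using tx bc xsym xtrans by blast
    then have "Q b = Q p" using Qx p by blast
    with Qt [OF p(1)] bc show False by simp
  qed
  have "Q i = Q j" if "(i, j) \<in> x" for i j
    using step [of i j] step [of j i] that xsym by (metis nat_neq_iff)
  then show "(k, l) \<in> krewL N x"
    using kl(1) by (auto simp: krewL_def uncrossed_def Q_def)
qed

lemma krewK_compl:
  assumes "nc N t" "nc N x" "t \<subseteq> x"
  shows "krewK N t \<inter> krewK N (x \<inter> krewK N t) \<subseteq> krewK N x"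
proof -
  have "krewL N (flip N t) \<inter> krewL N (flip N x \<inter> krewL N (flip N t)) \<subseteq> krewL N (flip N x)"
    using assms by (intro krewL_compl nc_flip flip_mono)
  from flip_mono [OF this, of N]
  have "flip N (krewL N (flip N t)) \<inter> flip N (krewL N (flip N (x \<inter> krewK N t)))
      \<subseteq> flip N (krewL N (flip N x))"
    unfolding flip_Int flip_krewK [OF assms(1)] .
  moreover have "nc N (x \<inter> krewK N t)"
    using assms by (intro nc_Int nc_krewK)
  ultimately show ?thesis
    unfolding krewK_flip [OF nc_subset [OF assms(1)]] krewK_flip [OF nc_subset [OF assms(2)]]
    using krewK_flip [OF nc_subset, of N "x \<inter> krewK N t"] krewK_flip [OF nc_subset [OF assms(1)]]
    by simp
qed

lemma nc_Id_on: "nc N (Id_on {0<..N})"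
  unfolding nc_def by (intro conjI) (auto simp: sym_def trans_def)

lemma nc_full: "nc N ({0<..N} \<times> {0<..N})"
  unfolding nc_def by (intro conjI) (auto simp: sym_def trans_def)

text \<open>Dropping the primes identifies both sets of points with 1, ..., N, so that both
  complements act on the same set of simple elements.\<close>

interpretation nc: kreweras "{R. nc N R}" "krewK N" "krewL N" "Id_on {0<..N}" "{0<..N} \<times> {0<..N}" for N
proof
  fix s t assume st: "s \<in> {R. nc N R}" "t \<in> {R. nc N R}" "s \<subseteq> t"
  show "krewK N t \<subseteq> krewK N s" "krewL N t \<subseteq> krewL N s"
    using st(3) by (auto simp: krewK_def krewL_def)
  show "krewK N s \<inter> krewK N (t \<inter> krewK N s) \<subseteq> krewK N t"
    using st krewK_compl by blast
  show "krewL N s \<inter> krewL N (t \<inter> krewL N s) \<subseteq> krewL N t"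
    using st krewL_compl by blast
next
  fix s assume "s \<in> {R. nc N R}"
  then have s: "nc N s" by simp
  show "Id_on {0<..N} \<subseteq> s" using nc_refl [OF s] by blast
  show "s \<subseteq> {0<..N} \<times> {0<..N}" by (rule nc_subset [OF s])
qed (simp_all add: nc_Int nc_krewK nc_krewL krewK_krewL krewL_krewK nc_Id_on nc_full)

section \<open>The dual braid monoid\<close>

lemma rtranclp_sym_lift:
  assumes "\<And>x y. r x y \<Longrightarrow> (sup q q\<inverse>\<inverse>)\<^sup>*\<^sup>* (f x) (f y)"
    and "(sup r r\<inverse>\<inverse>)\<^sup>*\<^sup>* x y"
  shows "(sup q q\<inverse>\<inverse>)\<^sup>*\<^sup>* (f x) (f y)"
  using assms(2)
proof (induction rule: rtranclp_induct)
  case (step y z)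
  have sym: "(sup q q\<inverse>\<inverse>)\<^sup>*\<^sup>* b a" if "(sup q q\<inverse>\<inverse>)\<^sup>*\<^sup>* a b" for a b
    using that sympD [OF symp_rtranclp, of "sup q q\<inverse>\<inverse>" a b] by (auto simp: symp_def)
  have "(sup q q\<inverse>\<inverse>)\<^sup>*\<^sup>* (f y) (f z)"
    using step.hyps(2) assms(1) sym by auto
  with step.IH show ?case by (rule rtranclp_trans)
qed simp

text \<open>The letter \<open>(i, j)\<close> stands for the band generator \<open>\<sigma>\<^sub>i\<^sub>,\<^sub>j\<close>; the steps are the relations
  of Birman, Ko and Lee.\<close>

type_synonym dword = "(nat \<times> nat) list"

inductive dual_step :: "dword \<Rightarrow> dword \<Rightarrow> bool" where
  tri1: "i < j \<Longrightarrow> j < k \<Longrightarrow> dual_step (u @ [(j, k), (i, j)] @ v) (u @ [(i, k), (j, k)] @ v)"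
| tri2: "i < j \<Longrightarrow> j < k \<Longrightarrow> dual_step (u @ [(j, k), (i, j)] @ v) (u @ [(i, j), (i, k)] @ v)"
| apart: "i < j \<Longrightarrow> j < k \<Longrightarrow> k < l \<Longrightarrow>
    dual_step (u @ [(i, j), (k, l)] @ v) (u @ [(k, l), (i, j)] @ v)"
| nested: "i < k \<Longrightarrow> k < l \<Longrightarrow> l < j \<Longrightarrow>
    dual_step (u @ [(i, j), (k, l)] @ v) (u @ [(k, l), (i, j)] @ v)"

definition dual_eq :: "dword \<Rightarrow> dword \<Rightarrow> bool" where
  "dual_eq = (sup dual_step dual_step\<inverse>\<inverse>)\<^sup>*\<^sup>*"

lemma dual_eq_refl [simp]: "dual_eq u u"
  by (simp add: dual_eq_def)

lemma dual_eq_trans [trans]: "dual_eq u v \<Longrightarrow> dual_eq v w \<Longrightarrow> dual_eq u w"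
  unfolding dual_eq_def by (rule rtranclp_trans)

lemma dual_eq_step: "dual_step u v \<Longrightarrow> dual_eq u v"
  unfolding dual_eq_def by auto

lemma dual_eq_sym: "dual_eq u v \<Longrightarrow> dual_eq v u"
  unfolding dual_eq_def using sympD [OF symp_rtranclp] by (metis (mono_tags) conversep_iff sup2CI sup2E sympI)

lemma dual_eq_context:
  assumes "dual_eq u v" shows "dual_eq (p @ u @ s) (p @ v @ s)"
  using assms unfolding dual_eq_def
proof (rule rtranclp_sym_lift [rotated, where f = "\<lambda>u. p @ u @ s"])
  fix x y assume "dual_step x y"
  then have "dual_step (p @ x @ s) (p @ y @ s)"
  proof cases
    case (tri1 i j k u v) then show ?thesis using dual_step.tri1 [of i j k "p @ u" "v @ s"] by simp
  next
    case (tri2 i j k u v) then show ?thesis using dual_step.tri2 [of i j k "p @ u" "v @ s"] by simp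
  next
    case (apart i j k l u v) then show ?thesis using dual_step.apart [of i j k l "p @ u" "v @ s"] by simp
  next
    case (nested i k l j u v) then show ?thesis using dual_step.nested [of i k l j "p @ u" "v @ s"] by simp
  qed
  then show "(sup dual_step dual_step\<inverse>\<inverse>)\<^sup>*\<^sup>* (p @ x @ s) (p @ y @ s)" by auto
qed

lemma dual_eq_append: "dual_eq u u' \<Longrightarrow> dual_eq v v' \<Longrightarrow> dual_eq (u @ v) (u' @ v')"
  using dual_eq_context [of u u' "[]" v] dual_eq_context [of v v' u' "[]"] dual_eq_trans by simp

lemma dual_eq_Cons: "dual_eq u v \<Longrightarrow> dual_eq (a # u) (a # v)"
  using dual_eq_append [of "[a]" "[a]" u v] by simp

definition dword :: "nat \<Rightarrow> dword \<Rightarrow> bool" where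
  "dword N u \<longleftrightarrow> (\<forall>(i, j) \<in> set u. 0 < i \<and> i < j \<and> j \<le> N)"

lemma dword_simps [simp]:
  "dword N []" "dword N ((i, j) # u) \<longleftrightarrow> 0 < i \<and> i < j \<and> j \<le> N \<and> dword N u"
  "dword N (u @ v) \<longleftrightarrow> dword N u \<and> dword N v"
  by (auto simp: dword_def)

section \<open>Atoms and words for simple elements\<close>

definition atom :: "nat \<Rightarrow> nat \<Rightarrow> nat \<Rightarrow> (nat \<times> nat) set" where
  "atom N i j = Id_on {0<..N} \<union> {(i, j), (j, i)}"

lemma nc_atom: "0 < i \<Longrightarrow> i < j \<Longrightarrow> j \<le> N \<Longrightarrow> nc N (atom N i j)"
  unfolding nc_def atom_def by (intro conjI) (auto simp: sym_def trans_def)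

lemma atom_subset_iff: "nc N s \<Longrightarrow> atom N i j \<subseteq> s \<longleftrightarrow> (i, j) \<in> s"
  unfolding atom_def using nc_refl [of N s] nc_sym [of N s i j] by blast

text \<open>This decides when the product of two letters is simple; the first letter is read on the
  primed points.\<close>

lemma atom_subset_krewK:
  assumes "0 < i" "i < j" "j \<le> N" "0 < k" "k < l" "l \<le> N"
  shows "atom N k l \<subseteq> krewK N (atom N i j) \<longleftrightarrow> uncrossed i j k l"
  using assms by (subst atom_subset_iff [OF nc_krewK [OF nc_atom]])
    (auto simp: krewK_def atom_def uncrossed_def)

text \<open>The inclusion in \<open>krewK\<close> makes every join a genuine product, so that
  \<open>u\<close> spells the simple element \<open>s\<close> in the monoid.\<close>

inductive rep :: "nat \<Rightarrow> dword \<Rightarrow> (nat \<times> nat) set \<Rightarrow> bool" for N where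
  Nil: "rep N [] (Id_on {0<..N})"
| Cons: "rep N u s \<Longrightarrow> 0 < i \<Longrightarrow> i < j \<Longrightarrow> j \<le> N \<Longrightarrow> s \<subseteq> krewK N (atom N i j) \<Longrightarrow>
    rep N ((i, j) # u) (nc.mul N (atom N i j) s)"

lemma nc_mul: "nc N s \<Longrightarrow> nc N t \<Longrightarrow> nc N (nc.mul N s t)"
  using nc.mul_in [of s N t] by simp

lemma rep_nc: "rep N u s \<Longrightarrow> nc N s"
  by (induction rule: rep.induct) (simp_all add: nc_Id_on nc_mul nc_atom)

lemma rep_dword: "rep N u s \<Longrightarrow> dword N u"
  by (induction rule: rep.induct) simp_all

lemma rep_append:
  assumes "rep N u s" "rep N v t" "t \<subseteq> krewK N s"
  shows "rep N (u @ v) (nc.mul N s t)"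
  using assms
proof (induction rule: rep.induct)
  case Nil
  then show ?case using rep_nc [OF Nil(1)] by simp
next
  case (Cons u s i j)
  have nc: "nc N s" "nc N t" "nc N (atom N i j)"
    using Cons rep_nc nc_atom by auto
  have t: "t \<subseteq> krewK N (atom N i j)" "t \<subseteq> krewK N s"
    using Cons.prems nc by (simp_all add: nc.K_mul)
  have "nc.mul N s t \<subseteq> krewK N (atom N i j)"
    using nc t Cons.hyps by (intro nc.mul_least) (simp_all add: nc_krewK)
  then have "rep N ((i, j) # u @ v) (nc.mul N (atom N i j) (nc.mul N s t))"
    using Cons t by (intro rep.Cons) auto
  then show ?case using nc by (simp add: nc.mul_assoc)
qed

lemma rep_atom:
  assumes "0 < i" "i < j" "j \<le> N"
  shows "rep N [(i, j)] (atom N i j)"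
  using rep.Cons [OF rep.Nil assms] nc_krewK [OF nc_atom [OF assms]] nc_atom [OF assms]
  by (simp add: nc.e_least)

section \<open>Existence and uniqueness of words for simple elements\<close>

lemma off_diagonal:
  assumes "nc N s" "s \<noteq> Id_on {0<..N}"
  obtains i j where "0 < i" "i < j" "j \<le> N" "(i, j) \<in> s"
proof -
  obtain i j where ij: "(i, j) \<in> s" "i \<noteq> j"
    using assms nc_refl [OF assms(1)] nc_bound [OF assms(1)] by (fastforce simp: Id_on_def)
  then show thesis
    using nc_bound [OF assms(1) ij(1)] nc_sym [OF assms(1) ij(1)] that [of i j] that [of j i]
    by (cases "i < j") auto
qed

lemma card_compl_less:
  assumes "nc N s" "0 < i" "i < j" "j \<le> N" "(i, j) \<in> s"
  shows "card (s \<inter> krewK N (atom N i j)) < card s"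
proof (rule psubset_card_mono)
  have "finite ({0<..N} \<times> {0<..N})" by simp
  then show "finite s" using nc_subset [OF assms(1)] finite_subset by blast
  have "(i, j) \<notin> krewK N (atom N i j)"
    using assms by (auto simp: krewK_def atom_def uncrossed_def)
  then show "s \<inter> krewK N (atom N i j) \<subset> s" using assms by blast
qed

lemma mul_atom_compl:
  assumes "nc N s" "0 < i" "i < j" "j \<le> N" "(i, j) \<in> s"
  shows "nc.mul N (atom N i j) (s \<inter> krewK N (atom N i j)) = s"
  using assms by (intro nc.mul_compl) (simp_all add: nc_atom atom_subset_iff)

lemma rep_Cons_compl:
  assumes "nc N s" "0 < i" "i < j" "j \<le> N" "(i, j) \<in> s" "rep N u (s \<inter> krewK N (atom N i j))"
  shows "rep N ((i, j) # u) s"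
  using rep.Cons [OF assms(6) assms(2-4)] mul_atom_compl [OF assms(1-5)] by simp

text \<open>Any off-diagonal pair of \<open>s\<close> is an atom dividing \<open>s\<close> on the
  left, and the quotient has fewer pairs.\<close>

lemma rep_ex: "nc N s \<Longrightarrow> \<exists>u. rep N u s"
proof (induction "card s" arbitrary: s rule: less_induct)
  case less
  show ?case
  proof (cases "s = Id_on {0<..N}")
    case False
    then obtain i j where ij: "0 < i" "i < j" "j \<le> N" "(i, j) \<in> s"
      using off_diagonal less.prems by metis
    then have "nc N (s \<inter> krewK N (atom N i j))"
      using less.prems by (intro nc_Int nc_krewK nc_atom)
    then show ?thesis
      using less.hyps card_compl_less rep_Cons_compl less.prems ij by metis
  qed (use rep.Nil in blast)
qed

lemma rep_Cons_inv:
  assumes "rep N ((i, j) # u) s"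
  shows "0 < i" "i < j" "j \<le> N" "(i, j) \<in> s" "rep N u (s \<inter> krewK N (atom N i j))"
proof -
  obtain t where t: "0 < i" "i < j" "j \<le> N" "rep N u t" "t \<subseteq> krewK N (atom N i j)"
    "s = nc.mul N (atom N i j) t"
    using assms by (auto elim: rep.cases)
  then show "0 < i" "i < j" "j \<le> N" by auto
  have nc: "nc N t" "nc N (atom N i j)" using t rep_nc nc_atom by auto
  show "(i, j) \<in> s" using nc.mul_ub1 [of "atom N i j" N t] nc t by (auto simp: atom_def)
  show "rep N u (s \<inter> krewK N (atom N i j))"
    using nc.compl_mul [of "atom N i j" N t] nc t by simp
qed

lemma rep_Id: "rep N u (Id_on {0<..N}) \<Longrightarrow> u = []"
proof (cases u)
  case (Cons a v)
  assume "rep N u (Id_on {0<..N})"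
  then show ?thesis
    using rep_Cons_inv(2,4) [of N "fst a" "snd a" v "Id_on {0<..N}"] Cons by (cases a) auto
qed simp

text \<open>The length-two relations in the form used for comparing words: both products are simple,
  and the last clause makes the joins agree for every \<open>N\<close>.\<close>

definition dual_pairs :: "nat \<times> nat \<Rightarrow> nat \<times> nat \<Rightarrow> nat \<times> nat \<Rightarrow> nat \<times> nat \<Rightarrow> bool" where
  "dual_pairs a a' b b' \<longleftrightarrow> dual_eq [a, a'] [b, b'] \<and>
     uncrossed (fst a) (snd a) (fst a') (snd a') \<and> uncrossed (fst b) (snd b) (fst b') (snd b') \<and>
     (\<forall>N s. nc N s \<longrightarrow> a \<in> s \<and> a' \<in> s \<longleftrightarrow> b \<in> s \<and> b' \<in> s)"

lemma dual_pairs_sym: "dual_pairs a a' b b' \<Longrightarrow> dual_pairs b b' a a'"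
  by (auto simp: dual_pairs_def dual_eq_sym)

lemma dual_pairs_triangle:
  assumes "i < j" "j < k"
  shows "dual_pairs (j, k) (i, j) (i, k) (j, k)" "dual_pairs (j, k) (i, j) (i, j) (i, k)"
    "dual_pairs (i, j) (i, k) (i, k) (j, k)"
proof -
  have s: "((j, k) \<in> s \<and> (i, j) \<in> s \<longleftrightarrow> (i, k) \<in> s \<and> (j, k) \<in> s) \<and>
      ((j, k) \<in> s \<and> (i, j) \<in> s \<longleftrightarrow> (i, j) \<in> s \<and> (i, k) \<in> s)" if "nc N s" for N s
    using nc_sym [OF that] nc_trans [OF that] by blast
  have 1: "dual_eq [(j, k), (i, j)] [(i, k), (j, k)]"
    using dual_eq_step [OF tri1 [OF assms, of "[]" "[]"]] by simp
  have 2: "dual_eq [(j, k), (i, j)] [(i, j), (i, k)]"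
    using dual_eq_step [OF tri2 [OF assms, of "[]" "[]"]] by simp
  show "dual_pairs (j, k) (i, j) (i, k) (j, k)"
    unfolding dual_pairs_def using 1 s assms by (auto simp: uncrossed_def)
  show "dual_pairs (j, k) (i, j) (i, j) (i, k)"
    unfolding dual_pairs_def using 2 s assms by (auto simp: uncrossed_def)
  show "dual_pairs (i, j) (i, k) (i, k) (j, k)"
    unfolding dual_pairs_def using dual_eq_trans [OF dual_eq_sym [OF 2] 1] s assms
    by (auto simp: uncrossed_def)
qed

lemma dual_pairs_apart:
  assumes "i < j" "j < k" "k < l"
  shows "dual_pairs (i, j) (k, l) (k, l) (i, j)"
  using dual_eq_step [OF apart [OF assms, of "[]" "[]"]] assms
  by (auto simp: dual_pairs_def uncrossed_def)

lemma dual_pairs_nested: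
  assumes "i < k" "k < l" "l < j"
  shows "dual_pairs (i, j) (k, l) (k, l) (i, j)"
  using dual_eq_step [OF nested [OF assms, of "[]" "[]"]] assms
  by (auto simp: dual_pairs_def uncrossed_def)

lemma dual_pairs_mul:
  assumes "dual_pairs (i, j) (i', j') (k, l) (k', l')"
    and "dword N [(i, j), (i', j'), (k, l), (k', l')]"
  shows "nc.mul N (atom N i j) (atom N i' j') = nc.mul N (atom N k l) (atom N k' l')"
proof -
  let ?a = "atom N i j" and ?a' = "atom N i' j'" and ?b = "atom N k l" and ?b' = "atom N k' l'"
  have nc: "nc N ?a" "nc N ?a'" "nc N ?b" "nc N ?b'"
    using assms(2) nc_atom by auto
  have p: "(i, j) \<in> s \<and> (i', j') \<in> s \<longleftrightarrow> (k, l) \<in> s \<and> (k', l') \<in> s" if "nc N s" for s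
    using assms(1) that unfolding dual_pairs_def by blast
  have ub: "?a \<subseteq> nc.mul N ?a ?a'" "?a' \<subseteq> nc.mul N ?a ?a'"
    "?b \<subseteq> nc.mul N ?b ?b'" "?b' \<subseteq> nc.mul N ?b ?b'"
    using nc by (simp_all add: nc.mul_ub1 nc.mul_ub2)
  have "?b \<subseteq> nc.mul N ?a ?a'" "?b' \<subseteq> nc.mul N ?a ?a'"
    "?a \<subseteq> nc.mul N ?b ?b'" "?a' \<subseteq> nc.mul N ?b ?b'"
    using ub p [OF nc_mul [OF nc(1,2)]] p [OF nc_mul [OF nc(3,4)]] nc
    by (simp_all add: atom_subset_iff nc_mul)
  then show ?thesis
    using nc by (intro equalityI nc.mul_least) (auto simp: nc_mul)
qed

text \<open>Induction on the size of \<open>s\<close>, comparing first letters. Letters that share a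
  string, lie apart or are nested have a common multiple below \<open>s\<close> to which a defining
  relation applies; crossing letters are linked through a third letter.\<close>

lemma rep_unique: "rep N u s \<Longrightarrow> rep N v s \<Longrightarrow> dual_eq u v"
proof (induction "card s" arbitrary: s u v rule: less_induct)
  case less
  have s: "nc N s" using less.prems rep_nc by blast
  have same: "dual_eq (a # u') (b # v')"
    if "rep N (a # u') s" "rep N (b # v') s" "a = b" for a b u' v'
  proof -
    obtain i j where a: "a = (i, j)" by fastforce
    have "dual_eq u' v'"
      using less.hyps [OF card_compl_less] rep_Cons_inv that s a by metis
    then show ?thesis using that by (simp add: dual_eq_Cons)
  qed
  \<comment> \<open>Let c = a a' = b b', and let \<open>w\<close> spell the quotient of
    \<open>s\<close> by \<open>c\<close>. Then a a' w and b b' w both spell \<open>s\<close>, and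
    the tails are compared by the induction hypothesis.\<close>
  have pairs: "dual_eq (a # u') (b # v')"
    if u: "rep N (a # u') s" and v: "rep N (b # v') s" and "dual_pairs a a' b b'"
      and a': "a' \<in> s" "fst a' < snd a'" and b': "fst b' < snd b'" for a b a' b' u' v'
  proof -
    obtain i j where a: "a = (i, j)" by fastforce
    obtain k l where b: "b = (k, l)" by fastforce
    obtain i' j' where ij': "a' = (i', j')" by fastforce
    obtain k' l' where kl': "b' = (k', l')" by fastforce
    note p = that(3) [unfolded a b ij' kl' dual_pairs_def, simplified]
    note ua = rep_Cons_inv [OF u [unfolded a]] and vb = rep_Cons_inv [OF v [unfolded b]]
    have b's: "b' \<in> s" using p s ua(4) a' ij' kl' by blast
    have bnd: "0 < i'" "i' < j'" "j' \<le> N" "0 < k'" "k' < l'" "l' \<le> N"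
      using nc_bound [OF s, of i' j'] nc_bound [OF s, of k' l'] a' b' b's ij' kl' by auto
    let ?a = "atom N i j" and ?a' = "atom N i' j'" and ?b = "atom N k l" and ?b' = "atom N k' l'"
    have nc: "nc N ?a" "nc N ?a'" "nc N ?b" "nc N ?b'"
      using bnd ua(1-3) vb(1-3) nc_atom by auto
    define c where "c = nc.mul N ?a ?a'"
    have ncc: "nc N c" unfolding c_def using nc nc_mul by blast
    have cb: "c = nc.mul N ?b ?b'"
      unfolding c_def using that(3) ua(1-3) vb(1-3) bnd
      by (intro dual_pairs_mul) (simp_all add: a b ij' kl')
    have cs: "c \<subseteq> s"
      unfolding c_def using nc s ua(4) a' ij' by (intro nc.mul_least) (auto simp: atom_subset_iff)
    have ncr: "nc N (s \<inter> krewK N c)" using s ncc nc_Int nc_krewK by blast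
    obtain w where w: "rep N w (s \<inter> krewK N c)" using rep_ex ncr by blast
    \<comment> \<open>Dividing \<open>s\<close> by the first factor of \<open>c\<close> leaves the
      second factor times the quotient of \<open>s\<close> by \<open>c\<close>.\<close>
    have tail: "rep N ((g, h) # w) (s \<inter> krewK N (atom N x y))"
      if "c = nc.mul N (atom N x y) (atom N g h)" "atom N g h \<subseteq> krewK N (atom N x y)"
        "nc N (atom N x y)" "0 < g" "g < h" "h \<le> N" for x y g h
    proof -
      let ?x = "atom N x y" and ?g = "atom N g h"
      have ncg: "nc N ?g" using that nc_atom by blast
      have Kc: "krewK N c = krewK N ?x \<inter> krewK N ?g" using that ncg by (simp add: nc.K_mul)
      have "nc.mul N ?x (nc.mul N ?g (s \<inter> krewK N c)) = nc.mul N c (s \<inter> krewK N c)"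
        using that ncg ncr by (simp add: nc.mul_assoc)
      also have "\<dots> = s" using ncc s cs by (simp add: nc.mul_compl)
      finally have "nc.mul N ?x (nc.mul N ?g (s \<inter> krewK N c)) = s" .
      moreover have "nc.mul N ?g (s \<inter> krewK N c) \<subseteq> krewK N ?x"
        using that ncg ncr Kc by (intro nc.mul_least) (auto simp: nc_krewK)
      ultimately have "s \<inter> krewK N ?x = nc.mul N ?g (s \<inter> krewK N c)"
        using nc.compl_mul [of ?x N "nc.mul N ?g (s \<inter> krewK N c)"] that ncg ncr by (simp add: nc_mul)
      moreover have "rep N ((g, h) # w) (nc.mul N ?g (s \<inter> krewK N c))"
        using w that Kc by (intro rep.Cons) auto
      ultimately show ?thesis by simp
    qed
    have "rep N (a' # w) (s \<inter> krewK N ?a)"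
      unfolding ij' using p bnd nc ua by (intro tail) (simp_all add: c_def atom_subset_krewK)
    then have 1: "dual_eq u' (a' # w)"
      using less.hyps [OF card_compl_less [OF s ua(1-4)] ua(5)] by blast
    have "rep N (b' # w) (s \<inter> krewK N ?b)"
      unfolding kl' using p bnd nc vb by (intro tail) (simp_all add: cb atom_subset_krewK)
    then have 2: "dual_eq v' (b' # w)"
      using less.hyps [OF card_compl_less [OF s vb(1-4)] vb(5)] by blast
    have "dual_eq (a # u') ([a, a'] @ w)" using 1 by (simp add: dual_eq_Cons)
    also have "dual_eq \<dots> ([b, b'] @ w)"
      using that(3) by (intro dual_eq_append) (simp_all add: dual_pairs_def)
    also have "dual_eq \<dots> (b # v')" using dual_eq_sym [OF 2] by (simp add: dual_eq_Cons)
    finally show ?thesis .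
  qed
  \<comment> \<open>Two edges of a triangle force the third one into \<open>s\<close>, so every
    letter of the triangle relations is available.\<close>
  have tri: "dual_eq (a # u') (b # v')"
    if "rep N (a # u') s" "rep N (b # v') s" "i < j" "j < k"
      "a \<in> {(i, j), (j, k), (i, k)}" "b \<in> {(i, j), (j, k), (i, k)}" for a b u' v' i j k
  proof (cases "a = b")
    case False
    have ab: "a \<in> s" "b \<in> s" using that rep_Cons_inv(4) by (metis prod.collapse)+
    have all: "(i, j) \<in> s" "(j, k) \<in> s" "(i, k) \<in> s"
      using ab False that(5,6) nc_sym [OF s] nc_trans [OF s] by blast+
    note t = dual_pairs_triangle [OF that(3,4)]
    show ?thesis
      using pairs [OF that(1,2)] t t [THEN dual_pairs_sym] all that(3-6) False by fastforce
  qed (use same that in blast)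
  show ?case
  proof (cases u)
    case Nil
    then have "s = Id_on {0<..N}" using less.prems by (auto elim: rep.cases)
    then show ?thesis using less.prems rep_Id [of N v] Nil by simp
  next
    case (Cons a u')
    note u = Cons
    show ?thesis
    proof (cases v)
      case Nil
      then have "s = Id_on {0<..N}" using less.prems by (auto elim: rep.cases)
      then show ?thesis using less.prems rep_Id [of N u] Cons by blast
    next
      case (Cons b v')
      obtain i j where a: "a = (i, j)" by fastforce
      obtain k l where b: "b = (k, l)" by fastforce
      have ru: "rep N ((i, j) # u') s" and rv: "rep N ((k, l) # v') s"
        using less.prems u Cons a b by auto
      note ua = rep_Cons_inv [OF ru] and vb = rep_Cons_inv [OF rv]
      \<comment> \<open>No defining relation contains two crossing letters. Noncrossing puts (p, p')
        into \<open>s\<close>, and this letter forms a triangle with each of them.\<close>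
      have crossing: "dual_eq ((p, q) # x) ((p', q') # y)"
        if "rep N ((p, q) # x) s" "rep N ((p', q') # y) s" "p < p'" "p' < q" "q < q'" for p q p' q' x y
      proof -
        note 1 = rep_Cons_inv [OF that(1)] and 2 = rep_Cons_inv [OF that(2)]
        have pp: "(p, p') \<in> s" using nc_cross [OF s 1(4) 2(4)] that by blast
        have "nc N (s \<inter> krewK N (atom N p p'))"
          using s 1 2 that by (intro nc_Int nc_krewK nc_atom) auto
        then obtain z where "rep N z (s \<inter> krewK N (atom N p p'))" using rep_ex by blast
        then have z: "rep N ((p, p') # z) s"
          using rep_Cons_compl [OF s _ _ _ pp] 1 2 that by auto
        have "dual_eq ((p, q) # x) ((p, p') # z)"
          using tri [OF that(1) z, of p p' q] that by blast
        also have "dual_eq \<dots> ((p', q') # y)"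
          using tri [OF z that(2), of p p' q'] that by force
        finally show ?thesis .
      qed
      consider "i = k" "j = l" | "i = k" "j < l" | "i = k" "l < j" | "j = l" "i < k" | "j = l" "k < i"
        | "j = k" | "l = i" | "j < k" | "l < i" | "i < k" "l < j" | "k < i" "j < l"
        | "i < k" "k < j" "j < l" | "k < i" "i < l" "l < j"
        using linorder_less_linear [of i k] linorder_less_linear [of j l]
          linorder_less_linear [of j k] linorder_less_linear [of l i] by argo
      then have "dual_eq ((i, j) # u') ((k, l) # v')"
      proof cases
        case 1 then show ?thesis using same ru rv by blast
      next
        case 2 then show ?thesis using tri [OF ru rv, of i j l] ua by blast
      next
        case 3 then show ?thesis using tri [OF ru rv, of i l j] vb by blast
      next
        case 4 then show ?thesis using tri [OF ru rv, of i k j] vb by blast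
      next
        case 5 then show ?thesis using tri [OF ru rv, of k i j] ua by blast
      next
        case 6 then show ?thesis using tri [OF ru rv, of i j l] ua vb by blast
      next
        case 7 then show ?thesis using tri [OF ru rv, of k l j] ua vb by blast
      next
        case 8 then show ?thesis
          using pairs [OF ru rv dual_pairs_apart] ua vb by simp
      next
        case 9 then show ?thesis
          using pairs [OF ru rv dual_pairs_sym [OF dual_pairs_apart]] ua vb by simp
      next
        case 10 then show ?thesis
          using pairs [OF ru rv dual_pairs_nested] ua vb by simp
      next
        case 11 then show ?thesis
          using pairs [OF ru rv dual_pairs_sym [OF dual_pairs_nested]] ua vb by simp
      next
        case 12 then show ?thesis using crossing [OF ru rv] by blast
      next
        case 13 then show ?thesis using dual_eq_sym [OF crossing [OF rv ru]] by blast
      qed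
      then show ?thesis using u Cons a b by simp
    qed
  qed
qed

section \<open>Words in the monoid and their normal forms\<close>

definition rep_list :: "nat \<Rightarrow> dword \<Rightarrow> (nat \<times> nat) set list \<Rightarrow> bool" where
  "rep_list N u l \<longleftrightarrow> (\<exists>us. list_all2 (rep N) us l \<and> dual_eq u (concat us))"

lemma rep_list_unique:
  assumes "rep_list N u l" "rep_list N v l"
  shows "dual_eq u v"
proof -
  have "dual_eq (concat us) (concat vs)"
    if "list_all2 (rep N) us l" "list_all2 (rep N) vs l" for us vs
    using that
  proof (induction l arbitrary: us vs rule: list.induct)
    case (Cons s l)
    then show ?case by (auto simp: list_all2_Cons2 intro!: dual_eq_append intro: rep_unique)
  qed simp
  with assms show ?thesis
    unfolding rep_list_def by (meson dual_eq_sym dual_eq_trans)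
qed

text \<open>The algorithm only moves a factor \<open>c\<close> from one simple element to the
  preceding one. By \<open>rep_unique\<close> a word for that element may be replaced by one that
  begins with a word for \<open>c\<close>, so the monoid element is unchanged.\<close>

lemma rep_list_act:
  "rep N w s \<Longrightarrow> rep_list N u l \<Longrightarrow> rep_list N (w @ u) (nc.act N s l)"
proof (induction l arbitrary: w s u)
  case Nil
  then have u: "dual_eq (w @ u) w"
    using dual_eq_append [of w w u "[]"] by (auto simp: rep_list_def)
  show ?case
  proof (cases "s = Id_on {0<..N}")
    case True
    then have "w = []" using Nil rep_Id by blast
    then show ?thesis using u True by (simp add: rep_list_def)
  next
    case False
    then show ?thesis using u Nil unfolding rep_list_def
      by (intro exI [of _ "[w]"]) simp
  qed
next
  case (Cons t l)
  then obtain u1 us where us: "rep N u1 t" "list_all2 (rep N) us l" "dual_eq u (u1 @ concat us)"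
    by (auto simp: rep_list_def list_all2_Cons2)
  have nc: "nc N s" "nc N t" using us Cons.prems rep_nc by auto
  define c where "c = krewK N s \<inter> t"
  have ncc: "nc N c" "nc N (t \<inter> krewK N c)"
    using nc by (auto simp: c_def intro!: nc_Int nc_krewK)
  obtain wc where wc: "rep N wc c" using rep_ex ncc by blast
  obtain wr where wr: "rep N wr (t \<inter> krewK N c)" using rep_ex ncc by blast
  have "rep N (wc @ wr) (nc.mul N c (t \<inter> krewK N c))"
    by (rule rep_append [OF wc wr]) simp
  also have "nc.mul N c (t \<inter> krewK N c) = t"
    using nc ncc by (intro nc.mul_compl) (auto simp: c_def)
  finally have u1: "dual_eq u1 (wc @ wr)" using us rep_unique by blast
  have wwc: "rep N (w @ wc) (nc.mul N s c)"
    by (rule rep_append [OF Cons.prems(1) wc]) (simp add: c_def)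
  have "rep_list N (wr @ concat us) (nc.act N (t \<inter> krewK N c) l)"
    using us by (intro Cons.IH [OF wr]) (auto simp: rep_list_def)
  then obtain vs where vs: "list_all2 (rep N) vs (nc.act N (t \<inter> krewK N c) l)"
      "dual_eq (wr @ concat us) (concat vs)"
    by (auto simp: rep_list_def)
  have "dual_eq (w @ u) (w @ u1 @ concat us)"
    using us by (intro dual_eq_append) auto
  also have "dual_eq \<dots> (w @ (wc @ wr) @ concat us)"
    using u1 by (rule dual_eq_context)
  also have "dual_eq \<dots> (concat ((w @ wc) # vs))"
    using dual_eq_context [OF vs(2), of "w @ wc" "[]"] by simp
  finally have "dual_eq (w @ u) (concat ((w @ wc) # vs))" .
  moreover have "list_all2 (rep N) ((w @ wc) # vs) (nc.act N s (t # l))"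
    using wwc vs by (simp add: c_def)
  ultimately show ?case unfolding rep_list_def by blast
qed

definition acts :: "nat \<Rightarrow> dword \<Rightarrow> (nat \<times> nat) set list" where
  "acts N u = foldr (\<lambda>(i, j). nc.act N (atom N i j)) u []"

lemma rep_list_acts: "dword N u \<Longrightarrow> rep_list N u (acts N u)"
proof (induction u)
  case Nil
  then show ?case by (simp add: acts_def rep_list_def)
next
  case (Cons a u)
  then show ?case
    using rep_list_act [OF rep_atom, of "fst a" "snd a" N u] by (cases a) (auto simp: acts_def)
qed

lemma dual_eq_if_acts_eq: "dword N u \<Longrightarrow> dword N v \<Longrightarrow> acts N u = acts N v \<Longrightarrow> dual_eq u v"
  using rep_list_acts rep_list_unique by metis

text \<open>\<open>D\<close> spells the greatest simple element. A right factor s of it leaves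
  \<open>krewL N s\<close> on the left; doing this twice gives D = y a and D = z y for a letter a,
  hence D a = z y a = z D.\<close>

lemma garside_word:
  obtains D where "dword N D"
    and "\<And>i j. 0 < i \<Longrightarrow> i < j \<Longrightarrow> j \<le> N \<Longrightarrow> \<exists>y. dword N y \<and> dual_eq D (y @ [(i, j)])"
    and "\<And>u. dword N u \<Longrightarrow> \<exists>u'. dword N u' \<and> dual_eq (D @ u) (u' @ D)"
proof -
  obtain D where D: "rep N D ({0<..N} \<times> {0<..N})" using rep_ex nc_full by blast
  have split: "\<exists>y. rep N y (krewL N s) \<and> dual_eq D (y @ w)" if w: "rep N w s" for w s
  proof -
    have s: "nc N s" using w rep_nc by blast
    obtain y where y: "rep N y (krewL N s)" using rep_ex nc_krewL by blast
    have "rep N (y @ w) (nc.mul N (krewL N s) s)"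
      using s by (intro rep_append y w) (simp add: krewK_krewL)
    then have "dual_eq D (y @ w)" using rep_unique D s by (simp add: nc.L_mul)
    with y show ?thesis by blast
  qed
  have letter: "\<exists>z. dword N z \<and> dual_eq (D @ [(i, j)]) (z @ D)" if ij: "0 < i" "i < j" "j \<le> N" for i j
  proof -
    obtain y where y: "rep N y (krewL N (atom N i j))" "dual_eq D (y @ [(i, j)])"
      using split [OF rep_atom [OF ij]] by blast
    obtain z where z: "rep N z (krewL N (krewL N (atom N i j)))" "dual_eq D (z @ y)"
      using split [OF y(1)] by blast
    have "dual_eq (D @ [(i, j)]) ((z @ y) @ [(i, j)])"
      using z by (intro dual_eq_append) auto
    also have "dual_eq \<dots> (z @ D)"
      using dual_eq_append [OF dual_eq_refl dual_eq_sym [OF y(2)], of z] by simp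
    finally show ?thesis using z rep_dword by blast
  qed
  show thesis
  proof (rule that [of D])
    show "dword N D" using D rep_dword by blast
    show "\<exists>y. dword N y \<and> dual_eq D (y @ [(i, j)])" if "0 < i" "i < j" "j \<le> N" for i j
      using split [OF rep_atom [OF that]] rep_dword by blast
    show "\<exists>u'. dword N u' \<and> dual_eq (D @ u) (u' @ D)" if "dword N u" for u
      using that
    proof (induction u)
      case Nil
      then show ?case by (intro exI [of _ "[]"]) simp
    next
      case (Cons a u)
      obtain i j where a: "a = (i, j)" by fastforce
      obtain z where z: "dword N z" "dual_eq (D @ [a]) (z @ D)"
        using letter [of i j] Cons.prems a by auto
      obtain u' where u': "dword N u'" "dual_eq (D @ u) (u' @ D)"
        using Cons a by auto
      have "dual_eq (D @ a # u) (z @ D @ u)"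
        using dual_eq_append [OF z(2) dual_eq_refl, of u] by simp
      also have "dual_eq \<dots> (z @ u' @ D)"
        using dual_eq_append [OF dual_eq_refl u'(2), of z] by simp
      finally show ?case using z u' by (intro exI [of _ "z @ u'"]) simp
    qed
  qed
qed

section \<open>Band generators in the braid group\<close>

lemma braid_eq_refl [simp]: "braid_eq n u u"
  by (simp add: braid_eq_def)

lemma braid_eq_trans [trans]: "braid_eq n u v \<Longrightarrow> braid_eq n v w \<Longrightarrow> braid_eq n u w"
  unfolding braid_eq_def by (rule rtranclp_trans)

lemma braid_eq_step: "braid_step n u v \<Longrightarrow> braid_eq n u v"
  unfolding braid_eq_def by auto

lemma braid_eq_sym: "braid_eq n u v \<Longrightarrow> braid_eq n v u"
  unfolding braid_eq_def using sympD [OF symp_rtranclp]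
  by (metis (mono_tags) conversep_iff sup2CI sup2E sympI)

lemma braid_eq_lift:
  assumes "\<And>x y. braid_step m x y \<Longrightarrow> braid_step n (f x) (f y)" "braid_eq m u v"
  shows "braid_eq n (f u) (f v)"
  using assms(2) unfolding braid_eq_def
proof (rule rtranclp_sym_lift [rotated])
  fix x y assume "braid_step m x y"
  then show "(sup (braid_step n) (braid_step n)\<inverse>\<inverse>)\<^sup>*\<^sup>* (f x) (f y)"
    using assms(1) by blast
qed

lemma braid_step_context:
  assumes "braid_step n x y" shows "braid_step n (p @ x @ s) (p @ y @ s)"
  using assms
proof cases
  case (cancel i u b v)
  then show ?thesis using braid_step.cancel [of i n "p @ u" b "v @ s"] by simp
next
  case (comm i j u v)
  then show ?thesis using braid_step.comm [of i n j "p @ u" "v @ s"] by simp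
next
  case (braid i u v)
  then show ?thesis using braid_step.braid [of i n "p @ u" "v @ s"] by simp
qed

lemma braid_eq_context: "braid_eq n u v \<Longrightarrow> braid_eq n (p @ u @ s) (p @ v @ s)"
  by (rule braid_eq_lift [where f = "\<lambda>u. p @ u @ s", OF braid_step_context])

lemma braid_eq_ctx:
  "braid_eq n u v \<Longrightarrow> x = p @ u @ s \<Longrightarrow> y = p @ v @ s \<Longrightarrow> braid_eq n x y"
  by (simp only: braid_eq_context)

lemma braid_eq_append: "braid_eq n u u' \<Longrightarrow> braid_eq n v v' \<Longrightarrow> braid_eq n (u @ v) (u' @ v')"
  using braid_eq_context [of n u u' "[]" v] braid_eq_context [of n v v' u' "[]"] braid_eq_trans
  by simp

lemma braid_word_simps [simp]:
  "braid_word n []" "braid_word n ((i, b) # u) \<longleftrightarrow> 1 \<le> i \<and> i < n \<and> braid_word n u"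
  "braid_word n (u @ v) \<longleftrightarrow> braid_word n u \<and> braid_word n v"
  by (auto simp: braid_word_def)

lemma inv_word_simps [simp]:
  "inv_word [] = []" "inv_word ((i, b) # u) = inv_word u @ [(i, \<not> b)]"
  "inv_word (u @ v) = inv_word v @ inv_word u"
  by (simp_all add: inv_word_def)

lemma inv_word_inv_word [simp]: "inv_word (inv_word u) = u"
  by (induction u) auto

lemma braid_word_inv_word [simp]: "braid_word n (inv_word u) \<longleftrightarrow> braid_word n u"
  by (induction u) auto

lemma braid_eq_right_inv: "braid_word n u \<Longrightarrow> braid_eq n (u @ inv_word u) []"
proof (induction u)
  case (Cons a u)
  obtain i b where a: "a = (i, b)" by fastforce
  have "braid_eq n (a # u @ inv_word u @ [(i, \<not> b)]) [(i, b), (i, \<not> b)]"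
    by (rule braid_eq_ctx [where p = "[a]" and s = "[(i, \<not> b)]", OF Cons.IH]) (use Cons a in auto)
  also have "braid_eq n \<dots> []"
    using braid_step.cancel [of i n "[]" b "[]"] Cons.prems a by (simp add: braid_eq_step)
  finally show ?case by (simp add: a)
qed simp

lemma braid_eq_left_inv: "braid_word n u \<Longrightarrow> braid_eq n (inv_word u @ u) []"
  using braid_eq_right_inv [of n "inv_word u"] by simp

lemma braid_eq_cancel_left:
  assumes "braid_eq n (p @ x) (p @ y)" "braid_word n p"
  shows "braid_eq n x y"
proof -
  have "braid_eq n x (inv_word p @ p @ x)"
    by (rule braid_eq_ctx [where p = "[]" and s = x, OF braid_eq_sym [OF braid_eq_left_inv [OF assms(2)]]]) auto
  also have "braid_eq n \<dots> (inv_word p @ p @ y)"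
    by (rule braid_eq_append [OF braid_eq_refl assms(1)])
  also have "braid_eq n \<dots> y"
    by (rule braid_eq_ctx [where p = "[]" and s = y, OF braid_eq_left_inv [OF assms(2)]]) auto
  finally show ?thesis .
qed

lemma braid_eq_cancel_right:
  assumes "braid_eq n (x @ p) (y @ p)" "braid_word n p"
  shows "braid_eq n x y"
proof -
  have "braid_eq n x (x @ p @ inv_word p)"
    by (rule braid_eq_ctx [where p = x and s = "[]", OF braid_eq_sym [OF braid_eq_right_inv [OF assms(2)]]]) auto
  also have "braid_eq n \<dots> (y @ p @ inv_word p)"
    using braid_eq_append [OF assms(1) braid_eq_refl, of "inv_word p"] by simp
  also have "braid_eq n \<dots> y"
    by (rule braid_eq_ctx [where p = y and s = "[]", OF braid_eq_right_inv [OF assms(2)]]) auto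
  finally show ?thesis .
qed

definition commute :: "nat \<Rightarrow> bword \<Rightarrow> bword \<Rightarrow> bool" where
  "commute n x y \<longleftrightarrow> braid_eq n (x @ y) (y @ x)"

lemma commute_sym: "commute n x y \<Longrightarrow> commute n y x"
  by (simp add: commute_def braid_eq_sym)

lemma commute_Nil: "commute n x []"
  by (simp add: commute_def)

lemma commute_append:
  assumes "commute n x y" "commute n x z" shows "commute n x (y @ z)"
proof -
  have "braid_eq n (x @ y @ z) (y @ x @ z)"
    using braid_eq_append [OF assms(1) [unfolded commute_def] braid_eq_refl, of z] by simp
  also have "braid_eq n \<dots> (y @ z @ x)"
    using braid_eq_append [OF braid_eq_refl assms(2) [unfolded commute_def], of y] by simp
  finally show ?thesis by (simp add: commute_def)
qed

lemma commute_inv: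
  assumes "commute n x y" "braid_word n y" shows "commute n x (inv_word y)"
proof -
  have "braid_eq n ((x @ inv_word y) @ y) x"
    by (rule braid_eq_ctx [where p = x and s = "[]", OF braid_eq_left_inv [OF assms(2)]]) auto
  also have "braid_eq n x (inv_word y @ y @ x)"
    by (rule braid_eq_ctx [where p = "[]" and s = x, OF braid_eq_sym [OF braid_eq_left_inv [OF assms(2)]]]) auto
  also have "braid_eq n \<dots> ((inv_word y @ x) @ y)"
    using braid_eq_append [OF braid_eq_refl braid_eq_sym [OF assms(1) [unfolded commute_def]]] by simp
  finally show ?thesis
    unfolding commute_def using assms(2) by (rule braid_eq_cancel_right)
qed

lemma commute_letters:
  assumes "braid_word n y" "\<And>a. a \<in> fst ` set y \<Longrightarrow> commute n x [(a, True)]"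
  shows "commute n x y"
  using assms
proof (induction y)
  case (Cons c y)
  obtain a b where c: "c = (a, b)" by fastforce
  have "commute n x [(a, True)]" using Cons.prems c by simp
  then have "commute n x [(a, b)]"
    using commute_inv [of n x "[(a, True)]"] Cons.prems c by (cases b) auto
  moreover have "commute n x y" using Cons c by simp
  ultimately show ?case using commute_append c by fastforce
qed (simp add: commute_Nil)

lemma commute_far:
  assumes "braid_word n x" "braid_word n y"
    "\<And>a b. a \<in> fst ` set x \<Longrightarrow> b \<in> fst ` set y \<Longrightarrow> a + 2 \<le> b"
  shows "commute n x y"
proof -
  have "commute n [(b, True)] x" if b: "b \<in> fst ` set y" for b
  proof (rule commute_letters [OF assms(1)])
    fix a assume a: "a \<in> fst ` set x"
    have "1 \<le> a" "a < n" "1 \<le> b" "b < n"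
      using a b assms(1,2) by (auto simp: braid_word_def)
    then have "commute n [(a, True)] [(b, True)]"
      using assms(3) [OF a b] braid_step.comm [of a n b "[]" "[]"]
      by (simp add: commute_def braid_eq_step)
    then show "commute n [(b, True)] [(a, True)]" by (rule commute_sym)
  qed
  from commute_letters [OF assms(2) commute_sym [OF this]] show ?thesis .
qed

section \<open>Relations between band generators\<close>

lemma tau_Suc: "j \<le> Suc k \<Longrightarrow> tau (Suc k) j = (Suc k, True) # tau k j"
  by (simp add: tau_def)

lemma band_Suc: "j \<le> k \<Longrightarrow> band j (Suc k) = [(Suc k, True)] @ band j k @ [(Suc k, False)]"
  by (simp add: band_def tau_Suc)

lemma band_self: "band j j = [(j, True), (j, True), (j, False)]"
  by (simp add: band_def tau_def)

lemma band_letters: "j \<le> k \<Longrightarrow> fst ` set (band j k) = {j..k}"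
proof (induction k rule: dec_induct)
  case (step k)
  then show ?case by (auto simp: band_Suc)
qed (auto simp: band_self)

lemma braid_word_band: "j \<le> k \<Longrightarrow> 1 \<le> j \<Longrightarrow> k < n \<Longrightarrow> braid_word n (band j k)"
proof (induction k rule: dec_induct)
  case (step k)
  then show ?case by (simp add: band_Suc)
qed (auto simp: band_self)

lemma braid_eq_band_self: "1 \<le> j \<Longrightarrow> j < n \<Longrightarrow> braid_eq n (band j j) [(j, True)]"
  using braid_step.cancel [of j n "[(j, True)]" True "[]"] by (simp add: band_self braid_eq_step)

text \<open>In the induction step y = p x p^-1, so the hypothesis p x p = x p x reads x y = p x.
  With p q p = q p q and x q = q x this turns x q y q into x y q y, and x is cancelled.\<close>

lemma band_braid:
  "i \<le> k \<Longrightarrow> 1 \<le> i \<Longrightarrow> Suc k < n \<Longrightarrow>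
    braid_eq n ([(Suc k, True)] @ band i k @ [(Suc k, True)]) (band i k @ [(Suc k, True)] @ band i k)"
proof (induction k rule: dec_induct)
  case base
  have b: "braid_eq n (band i i) [(i, True)]" using base by (simp add: braid_eq_band_self)
  have "braid_eq n ([(Suc i, True)] @ band i i @ [(Suc i, True)]) [(Suc i, True), (i, True), (Suc i, True)]"
    by (rule braid_eq_ctx [OF b, where p = "[(Suc i, True)]" and s = "[(Suc i, True)]"]) auto
  also have "braid_eq n \<dots> ([(i, True)] @ [(Suc i, True)] @ [(i, True)])"
    using braid_step.braid [of i n "[]" "[]"] base by (simp add: braid_eq_sym braid_eq_step)
  also have "braid_eq n \<dots> (band i i @ [(Suc i, True)] @ band i i)"
    using b by (intro braid_eq_append) (auto intro: braid_eq_sym)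
  finally show ?case .
next
  case (step k)
  define p where "p = [(Suc k, True)]"
  define q where "q = [(Suc (Suc k), True)]"
  define x where "x = band i k"
  define y where "y = band i (Suc k)"
  have w: "braid_word n p" "braid_word n q" "braid_word n x" "braid_word n (inv_word x)"
    using step by (auto simp: p_def q_def x_def braid_word_band)
  have y: "y = p @ x @ inv_word p" using step by (simp add: y_def x_def p_def band_Suc)
  have px: "braid_eq n (p @ x @ p) (x @ p @ x)" using step by (simp add: p_def x_def)
  have pq: "braid_eq n (p @ q @ p) (q @ p @ q)"
    using braid_step.braid [of "Suc k" n "[]" "[]"] step by (simp add: p_def q_def braid_eq_step)
  have xq: "commute n x q"
    using step w by (intro commute_far) (auto simp: x_def q_def band_letters)
  have xy: "braid_eq n (x @ y) (p @ x)"
  proof -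
    have "braid_eq n (x @ y) (p @ x @ p @ inv_word p)"
      by (rule braid_eq_ctx [OF braid_eq_sym [OF px], where p = "[]" and s = "inv_word p"]) (auto simp: y)
    also have "braid_eq n \<dots> (p @ x)"
      by (rule braid_eq_ctx [OF braid_eq_right_inv [OF w(1)], where p = "p @ x" and s = "[]"]) auto
    finally show ?thesis .
  qed
  have "braid_eq n (x @ q @ y @ q) (q @ x @ y @ q)"
    by (rule braid_eq_ctx [OF xq [unfolded commute_def], where p = "[]" and s = "y @ q"]) auto
  also have "braid_eq n \<dots> (q @ p @ x @ q)"
    by (rule braid_eq_ctx [OF xy, where p = q and s = q]) auto
  also have "braid_eq n \<dots> (q @ p @ q @ x)"
    by (rule braid_eq_ctx [OF xq [unfolded commute_def], where p = "q @ p" and s = "[]"]) auto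
  also have "braid_eq n \<dots> (p @ q @ p @ x)"
    by (rule braid_eq_ctx [OF braid_eq_sym [OF pq], where p = "[]" and s = x]) auto
  also have "braid_eq n \<dots> (p @ q @ x @ y)"
    by (rule braid_eq_ctx [OF braid_eq_sym [OF xy], where p = "p @ q" and s = "[]"]) auto
  also have "braid_eq n \<dots> (p @ x @ q @ y)"
    by (rule braid_eq_ctx [OF braid_eq_sym [OF xq [unfolded commute_def]], where p = p and s = y]) auto
  also have "braid_eq n \<dots> (x @ y @ q @ y)"
    by (rule braid_eq_ctx [OF braid_eq_sym [OF xy], where p = "[]" and s = "q @ y"]) auto
  finally have "braid_eq n (q @ y @ q) (y @ q @ y)"
    using w(3) by (rule braid_eq_cancel_left)
  then show ?case by (simp add: q_def y_def)
qed

text \<open>A letter names two strings, whereas the second argument of \<open>band\<close> is the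
  index of the last generator; hence \<open>j - 1\<close>.\<close>

definition bands :: "dword \<Rightarrow> bword" where
  "bands u = concat (map (\<lambda>(i, j). band i (j - 1)) u)"

lemma bands_simps [simp]:
  "bands [] = []" "bands ((i, j) # u) = band i (j - 1) @ bands u" "bands (u @ v) = bands u @ bands v"
  by (simp_all add: bands_def)

lemma braid_word_bands: "dword n u \<Longrightarrow> braid_word n (bands u)"
  by (induction u) (auto intro!: braid_word_band)

text \<open>The relation for \<open>k\<close> is conjugated by the generator with index
  \<open>k\<close>, which commutes with the band of \<open>i\<close> and \<open>j\<close>. In each
  case all three words are brought to one common word.\<close>

lemma bands_triangle:
  assumes "1 \<le> i" "i < j" "j < k" "k \<le> n"
  shows "braid_eq n (bands [(j, k), (i, j)]) (bands [(i, k), (j, k)])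
    \<and> braid_eq n (bands [(j, k), (i, j)]) (bands [(i, j), (i, k)])"
proof -
  have "Suc j \<le> k" using assms by simp
  then show ?thesis using assms(4)
  proof (induction k rule: dec_induct)
    case base
    define g where "g = [(j, True)]"
    define x where "x = band i (j - 1)"
    define y where "y = band i j"
    have w: "braid_word n g" using assms by (simp add: g_def)
    have y: "y = g @ x @ inv_word g"
      using assms band_Suc [of i "j - 1"] by (simp add: y_def x_def g_def)
    have b: "braid_eq n (band j j) g" using assms by (simp add: g_def braid_eq_band_self)
    have l: "braid_eq n (band j j @ x) (g @ x)" by (rule braid_eq_append [OF b braid_eq_refl])
    have "braid_eq n (y @ band j j) (y @ g)" by (rule braid_eq_append [OF braid_eq_refl b])
    also have "braid_eq n \<dots> (g @ x)"
      by (rule braid_eq_ctx [OF braid_eq_left_inv [OF w], where p = "g @ x" and s = "[]"]) (auto simp: y)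
    finally have 1: "braid_eq n (y @ band j j) (g @ x)" .
    have br: "braid_eq n (g @ x @ g) (x @ g @ x)"
      using band_braid [of i "j - 1" n] assms base by (simp add: g_def x_def)
    have "braid_eq n (x @ y) (g @ x @ g @ inv_word g)"
      by (rule braid_eq_ctx [OF braid_eq_sym [OF br], where p = "[]" and s = "inv_word g"]) (auto simp: y)
    also have "braid_eq n \<dots> (g @ x)"
      by (rule braid_eq_ctx [OF braid_eq_right_inv [OF w], where p = "g @ x" and s = "[]"]) auto
    finally have 2: "braid_eq n (x @ y) (g @ x)" .
    show ?case
      using braid_eq_trans [OF l braid_eq_sym [OF 1]] braid_eq_trans [OF l braid_eq_sym [OF 2]]
      by (simp add: x_def y_def)
  next
    case (step k)
    define g where "g = [(k, True)]"
    define x where "x = band i (j - 1)"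
    define y where "y = band i (k - 1)"
    define z where "z = band j (k - 1)"
    have w: "braid_word n g" using assms step by (simp add: g_def)
    have y': "band i k = g @ y @ inv_word g"
      using assms step band_Suc [of i "k - 1"] by (simp add: y_def g_def)
    have z': "band j k = g @ z @ inv_word g"
      using assms step band_Suc [of j "k - 1"] by (simp add: z_def g_def)
    have IH: "braid_eq n (z @ x) (y @ z)" "braid_eq n (z @ x) (x @ y)"
      using step by (simp_all add: x_def y_def z_def)
    have xg: "commute n x g"
      using assms step w by (intro commute_far) (auto simp: x_def g_def band_letters braid_word_band)
    then have xg': "commute n x (inv_word g)" using w commute_inv by blast
    have l: "braid_eq n (band j k @ x) (g @ z @ x @ inv_word g)"
      by (rule braid_eq_ctx [OF braid_eq_sym [OF xg' [unfolded commute_def]], where p = "g @ z" and s = "[]"])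
        (auto simp: z')
    have "braid_eq n (band i k @ band j k) (g @ y @ z @ inv_word g)"
      by (rule braid_eq_ctx [OF braid_eq_left_inv [OF w], where p = "g @ y" and s = "z @ inv_word g"])
        (auto simp: y' z')
    also have "braid_eq n \<dots> (g @ z @ x @ inv_word g)"
      by (rule braid_eq_ctx [OF braid_eq_sym [OF IH(1)], where p = g and s = "inv_word g"]) auto
    finally have 1: "braid_eq n (band i k @ band j k) (g @ z @ x @ inv_word g)" .
    have "braid_eq n (x @ band i k) (g @ x @ y @ inv_word g)"
      by (rule braid_eq_ctx [OF xg [unfolded commute_def], where p = "[]" and s = "y @ inv_word g"])
        (auto simp: y')
    also have "braid_eq n \<dots> (g @ z @ x @ inv_word g)"
      by (rule braid_eq_ctx [OF braid_eq_sym [OF IH(2)], where p = g and s = "inv_word g"]) auto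
    finally have 2: "braid_eq n (x @ band i k) (g @ z @ x @ inv_word g)" .
    show ?case
      using braid_eq_trans [OF l braid_eq_sym [OF 1]] braid_eq_trans [OF l braid_eq_sym [OF 2]]
      by (simp add: x_def)
  qed
qed

text \<open>For \<open>k = Suc m\<close> the band is (q p) x (q p)^-1, where x commutes with q, and
  the braid relation p q p = q p q suffices. Larger bands arise by conjugation with generators far
  from \<open>m\<close>.\<close>

lemma commute_nested_letter:
  assumes "1 \<le> i" "i < m" "m < k" "k < n"
  shows "commute n (band i k) [(m, True)]"
proof -
  have "Suc m \<le> k" using assms by simp
  then show ?thesis using assms(4)
  proof (induction k rule: dec_induct)
    case base
    define p where "p = [(m, True)]"
    define q where "q = [(Suc m, True)]"
    define x where "x = band i (m - 1)"
    have w: "braid_word n p" "braid_word n q" "braid_word n x" "braid_word n (q @ p)"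
      using assms base by (auto simp: p_def q_def x_def intro!: braid_word_band)
    have b: "band i (Suc m) = q @ p @ x @ inv_word p @ inv_word q"
      using assms band_Suc [of i m] band_Suc [of i "m - 1"] by (simp add: p_def q_def x_def)
    have pq: "braid_eq n (p @ q @ p) (q @ p @ q)"
      using braid_step.braid [of m n "[]" "[]"] assms base by (simp add: p_def q_def braid_eq_step)
    have xq: "commute n x q"
      using assms w by (intro commute_far) (auto simp: x_def q_def band_letters)
    have inv: "braid_eq n (inv_word p @ inv_word q @ q @ p) []"
      using braid_eq_left_inv [OF w(4)] by simp
    \<comment> \<open>The factor \<open>q @ p\<close> on the right absorbs the inverses at the end
      of the band; it is cancelled once both sides agree.\<close>
    have "braid_eq n ((band i (Suc m) @ p) @ q @ p) (band i (Suc m) @ q @ p @ q)"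
      by (rule braid_eq_ctx [OF pq, where p = "band i (Suc m)" and s = "[]"]) auto
    also have "braid_eq n \<dots> (q @ p @ x @ q)"
      by (rule braid_eq_ctx [OF inv, where p = "q @ p @ x" and s = q]) (auto simp: b)
    also have "braid_eq n \<dots> (q @ p @ q @ x)"
      by (rule braid_eq_ctx [OF xq [unfolded commute_def], where p = "q @ p" and s = "[]"]) auto
    also have "braid_eq n \<dots> (p @ q @ p @ x)"
      by (rule braid_eq_ctx [OF braid_eq_sym [OF pq], where p = "[]" and s = x]) auto
    also have "braid_eq n \<dots> ((p @ band i (Suc m)) @ q @ p)"
      by (rule braid_eq_ctx [OF braid_eq_sym [OF inv], where p = "p @ q @ p @ x" and s = "[]"]) (auto simp: b)
    finally have "braid_eq n (band i (Suc m) @ p) (p @ band i (Suc m))"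
      using w(4) by (rule braid_eq_cancel_right)
    then show ?case by (simp add: commute_def p_def)
  next
    case (step k)
    have "commute n [(m, True)] [(Suc k, True)]"
      using assms step by (intro commute_far) auto
    then have "commute n [(m, True)] [(Suc k, b)]" for b
      using commute_inv [of n "[(m, True)]" "[(Suc k, True)]"] step by (cases b) auto
    moreover have "commute n [(m, True)] (band i k)"
      using step commute_sym by auto
    ultimately have "commute n [(m, True)] (band i (Suc k))"
      using assms step by (simp add: band_Suc) (metis append_Cons append_Nil commute_append)
    then show ?case by (rule commute_sym)
  qed
qed

text \<open>Both sides of a defining relation mention the same strings, so bounds pass either way;
  the disjunction serves both directions of a rewriting chain.\<close>

lemma dual_step_braid_eq:
  assumes "dual_step u v" "dword n u \<or> dword n v"
  shows "dword n u" "dword n v" "braid_eq n (bands u) (bands v)"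
proof -
  have *: "dword n u \<and> dword n v \<and> braid_eq n (bands u) (bands v)"
    using assms
  proof cases
    case (tri1 i j k p s)
    then have "1 \<le> i" "k \<le> n" using assms(2) by auto
    then have "braid_eq n (bands p @ bands [(j, k), (i, j)] @ bands s) (bands p @ bands [(i, k), (j, k)] @ bands s)"
      using tri1 bands_triangle braid_eq_context by blast
    then show ?thesis using tri1 assms(2) by auto
  next
    case (tri2 i j k p s)
    then have "1 \<le> i" "k \<le> n" using assms(2) by auto
    then have "braid_eq n (bands p @ bands [(j, k), (i, j)] @ bands s) (bands p @ bands [(i, j), (i, k)] @ bands s)"
      using tri2 bands_triangle braid_eq_context by blast
    then show ?thesis using tri2 assms(2) by auto
  next
    case (apart i j k l p s)
    then have d: "0 < i" "l \<le> n" using assms(2) by auto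
    have "commute n (band i (j - 1)) (band k (l - 1))"
      using apart d by (intro commute_far braid_word_band) (auto simp: band_letters)
    from braid_eq_context [OF this [unfolded commute_def], of "bands p" "bands s"]
    show ?thesis using apart assms(2) by auto
  next
    case (nested i k l j p s)
    then have d: "0 < i" "j \<le> n" using assms(2) by auto
    have "commute n (band i (j - 1)) (band k (l - 1))"
    proof (rule commute_letters)
      show "braid_word n (band k (l - 1))"
        using nested d by (intro braid_word_band) auto
      fix a assume "a \<in> fst ` set (band k (l - 1))"
      then have "k \<le> a" "a \<le> l - 1" using nested by (auto simp: band_letters)
      then show "commute n (band i (j - 1)) [(a, True)]"
        using nested d by (intro commute_nested_letter) auto
    qed
    from braid_eq_context [OF this [unfolded commute_def], of "bands p" "bands s"]
    show ?thesis using nested assms(2) by auto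
  qed
  then show "dword n u" "dword n v" "braid_eq n (bands u) (bands v)" by auto
qed

lemma dual_eq_braid_eq:
  assumes "dual_eq u v" "dword n u"
  shows "dword n v \<and> braid_eq n (bands u) (bands v)"
  using assms(1) unfolding dual_eq_def
proof (induction rule: rtranclp_induct)
  case (step v w)
  then have "dword n w \<and> braid_eq n (bands v) (bands w)"
    using dual_step_braid_eq [of v w n] dual_step_braid_eq [of w v n] braid_eq_sym by auto
  then show ?case using step braid_eq_trans by blast
qed (use assms(2) in simp)

text \<open>Induction from the right end of \<open>X\<close>. A positive letter is appended to
  \<open>P\<close>. For an inverse letter, multiply by \<open>D\<close> on the left: in D P = P' D
  the last factor can be spelled to end in the positive letter, which cancels.\<close>

lemma denominator:
  "braid_word n X \<Longrightarrow> \<exists>A P. dword n A \<and> dword n P \<and> braid_eq n (bands A @ X) (bands P)"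
proof (induction X rule: rev_induct)
  case Nil
  then show ?case by (intro exI [of _ "[]"]) simp
next
  case (snoc c X)
  obtain i b where c: "c = (i, b)" by fastforce
  then have i: "1 \<le> i" "i < n" using snoc.prems by auto
  obtain A P where AP: "dword n A" "dword n P" "braid_eq n (bands A @ X) (bands P)"
    using snoc by auto
  have s: "braid_eq n (bands [(i, Suc i)]) [(i, True)]" using i by (simp add: braid_eq_band_self)
  have AX: "braid_eq n (bands A @ X @ [c]) (bands P @ [c])"
    using braid_eq_append [OF AP(3) braid_eq_refl, of "[c]"] by simp
  show ?case
  proof (cases b)
    case True
    have "braid_eq n (bands P @ [c]) (bands (P @ [(i, Suc i)]))"
      using braid_eq_append [OF braid_eq_refl braid_eq_sym [OF s], of "bands P"] c True by simp
    with AX have "braid_eq n (bands A @ X @ [c]) (bands (P @ [(i, Suc i)]))"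
      by (rule braid_eq_trans)
    then show ?thesis using AP i by (intro exI [of _ A] exI [of _ "P @ [(i, Suc i)]"]) simp
  next
    case False
    obtain D where D: "dword n D"
      "\<And>i j. 0 < i \<Longrightarrow> i < j \<Longrightarrow> j \<le> n \<Longrightarrow> \<exists>y. dword n y \<and> dual_eq D (y @ [(i, j)])"
      "\<And>u. dword n u \<Longrightarrow> \<exists>u'. dword n u' \<and> dual_eq (D @ u) (u' @ D)"
      using garside_word by metis
    obtain y where y: "dword n y" "dual_eq D (y @ [(i, Suc i)])" using D(2) [of i "Suc i"] i by auto
    obtain P' where P': "dword n P'" "dual_eq (D @ P) (P' @ D)" using D(3) AP by blast
    have "dual_eq (D @ P) (P' @ y @ [(i, Suc i)])"
      using dual_eq_trans [OF P'(2) dual_eq_append [OF dual_eq_refl y(2)]] by simp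
    then have "braid_eq n (bands (D @ P)) (bands (P' @ y @ [(i, Suc i)]))"
      using dual_eq_braid_eq [of "D @ P"] D(1) AP(2) by (metis dword_simps(3))
    then have DP: "braid_eq n (bands D @ bands P @ [c]) (bands P' @ bands y @ bands [(i, Suc i)] @ [c])"
      using braid_eq_append [OF _ braid_eq_refl, of n _ _ "[c]"] by fastforce
    have "braid_eq n (bands (D @ A) @ X @ [c]) (bands D @ bands P @ [c])"
      using braid_eq_append [OF braid_eq_refl AX] by simp
    also note DP
    also have "braid_eq n (bands P' @ bands y @ bands [(i, Suc i)] @ [c])
        (bands P' @ bands y @ [(i, True), (i, False)])"
      by (rule braid_eq_ctx [OF s, where p = "bands P' @ bands y" and s = "[c]"]) (auto simp: c False)
    also have "braid_eq n \<dots> (bands (P' @ y))"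
      using braid_step.cancel [of i n "bands P' @ bands y" True "[]"] i by (simp add: braid_eq_step)
    finally show ?thesis
      using AP D P' y by (intro exI [of _ "D @ A"] exI [of _ "P' @ y"]) simp
  qed
qed

section \<open>Embedding of the dual monoid and splitting\<close>

abbreviation fractions :: "nat \<Rightarrow> (nat \<times> (nat \<times> nat) set list) set" where
  "fractions N \<equiv> UNIV \<times> nc.nf N"

definition run :: "nat \<Rightarrow> bword \<Rightarrow> nat \<times> (nat \<times> nat) set list \<Rightarrow> nat \<times> (nat \<times> nat) set list" where
  "run N w x = foldr (\<lambda>(i, b). (if b then nc.pos else nc.neg) N (atom N i (Suc i))) w x"

lemma run_simps [simp]:
  "run N [] x = x"
  "run N ((i, True) # w) x = nc.pos N (atom N i (Suc i)) (run N w x)"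
  "run N ((i, False) # w) x = nc.neg N (atom N i (Suc i)) (run N w x)"
  "run N (v @ w) x = run N v (run N w x)"
  by (simp_all add: run_def)

lemma run_in: "braid_word N w \<Longrightarrow> x \<in> fractions N \<Longrightarrow> run N w x \<in> fractions N"
proof (induction w)
  case (Cons c w)
  obtain i b where c: "c = (i, b)" by fastforce
  have "run N w x \<in> fractions N" "nc N (atom N i (Suc i))"
    using Cons c nc_atom by auto
  then show ?case
    using nc.pos_in [of "atom N i (Suc i)" N "run N w x"] nc.neg_in [of "atom N i (Suc i)" N "run N w x"]
    by (cases b) (simp_all add: c)
qed simp

lemma run_cong:
  "braid_word N w \<Longrightarrow> x \<in> fractions N \<Longrightarrow> y \<in> fractions N \<Longrightarrow> nc.eqv N x y \<Longrightarrow>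
    nc.eqv N (run N w x) (run N w y)"
proof (induction w)
  case (Cons c w)
  obtain i b where c: "c = (i, b)" by fastforce
  have "run N w x \<in> fractions N" "run N w y \<in> fractions N" "nc N (atom N i (Suc i))"
    "nc.eqv N (run N w x) (run N w y)"
    using Cons c nc_atom by (auto intro!: run_in)
  then show ?case
    using nc.pos_cong [of "atom N i (Suc i)" N] nc.neg_cong [of "atom N i (Suc i)" N]
    by (cases b) (simp_all add: c)
qed simp

text \<open>Both two-letter products are simple, so each side is the action of their common
  join.\<close>

lemma pos_dual_pairs:
  assumes "dual_pairs (i, j) (i', j') (k, l) (k', l')"
    "dword N [(i, j), (i', j'), (k, l), (k', l')]" "x \<in> fractions N"
  shows "nc.pos N (atom N i j) (nc.pos N (atom N i' j') x) =
    nc.pos N (atom N k l) (nc.pos N (atom N k' l') x)"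
proof -
  have u: "uncrossed i j i' j'" "uncrossed k l k' l'" using assms(1) by (auto simp: dual_pairs_def)
  have "nc.pos N (atom N i j) (nc.pos N (atom N i' j') x) = nc.pos N (nc.mul N (atom N i j) (atom N i' j')) x"
    using u assms(2,3) by (intro nc.pos_mul) (simp_all add: nc_atom atom_subset_krewK)
  also have "\<dots> = nc.pos N (nc.mul N (atom N k l) (atom N k' l')) x"
    using dual_pairs_mul assms by metis
  also have "\<dots> = nc.pos N (atom N k l) (nc.pos N (atom N k' l') x)"
    using u assms(2,3) by (intro nc.pos_mul [symmetric]) (simp_all add: nc_atom atom_subset_krewK)
  finally show ?thesis .
qed

lemma braid_step_word: "braid_step N u v \<Longrightarrow> braid_word N u \<longleftrightarrow> braid_word N v"
  by (induction rule: braid_step.induct) auto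

text \<open>Cancelling a generator against its inverse changes the denominator and so holds up to
  \<open>eqv\<close>; the two positive relations hold exactly.\<close>

lemma run_step:
  assumes "braid_step N u v" "braid_word N u" "x \<in> fractions N"
  shows "nc.eqv N (run N u x) (run N v x)"
  using assms(1)
proof cases
  case (cancel i p b s)
  let ?a = "atom N i (Suc i)"
  have w: "braid_word N p" "braid_word N s" using assms(2) cancel by auto
  have y: "run N s x \<in> fractions N" using w assms by (intro run_in)
  have a: "nc N ?a" using cancel by (intro nc_atom) auto
  have "nc.eqv N (run N [(i, b), (i, \<not> b)] (run N s x)) (run N s x)"
    using nc.pos_neg [of ?a N "run N s x"] nc.neg_pos [of ?a N "run N s x"] a y by (cases b) simp_all
  moreover have "run N [(i, b), (i, \<not> b)] (run N s x) \<in> fractions N"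
    by (rule run_in) (use cancel y in simp_all)
  ultimately have "nc.eqv N (run N p (run N [(i, b), (i, \<not> b)] (run N s x))) (run N p (run N s x))"
    using w y by (intro run_cong)
  then show ?thesis by (simp only: cancel run_simps(4))
next
  case (comm i j p s)
  have "run N s x \<in> fractions N" using comm assms by (intro run_in) auto
  then have "run N [(i, True), (j, True)] (run N s x) = run N [(j, True), (i, True)] (run N s x)"
    using comm pos_dual_pairs [OF dual_pairs_apart, of i "Suc i" j "Suc j" N] by simp
  then have "run N u x = run N v x" by (simp only: comm run_simps(4))
  then show ?thesis by simp
next
  case (braid i p s)
  define y where "y = run N s x"
  have y: "y \<in> fractions N" unfolding y_def using braid assms by (intro run_in) auto
  let ?a = "nc.pos N (atom N i (Suc i))" and ?b = "nc.pos N (atom N (Suc i) (Suc (Suc i)))"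
    and ?c = "nc.pos N (atom N i (Suc (Suc i)))"
  have by2: "?b y \<in> fractions N" using y braid by (intro nc.pos_in) (auto intro: nc_atom)
  \<comment> \<open>With the third edge c of the triangle, b a b = a c b = a b a.\<close>
  have "?b (?a (?b y)) = ?a (?c (?b y))"
    using braid by (intro pos_dual_pairs by2 dual_pairs_triangle) auto
  also have "?c (?b y) = ?b (?a y)"
    using braid y by (intro pos_dual_pairs [OF dual_pairs_sym] dual_pairs_triangle) auto
  finally have "run N [(i, True), (Suc i, True), (i, True)] y = run N [(Suc i, True), (i, True), (Suc i, True)] y"
    by simp
  then have "run N u x = run N v x" by (simp only: braid run_simps(4) y_def)
  then show ?thesis by simp
qed

lemma run_eq:
  assumes "braid_eq N u v" "braid_word N u" "x \<in> fractions N"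
  shows "braid_word N v \<and> nc.eqv N (run N u x) (run N v x)"
  using assms(1) unfolding braid_eq_def
proof (induction rule: rtranclp_induct)
  case (step v w)
  then have w: "braid_word N v" "braid_word N w" using braid_step_word by auto
  then have "nc.eqv N (run N v x) (run N w x)"
    using step.hyps(2) run_step [of N v w x] run_step [of N w v x] assms(3) nc.eqv_sym by blast
  with step w show ?case
    using nc.eqv_trans [of N "run N u x" "run N v x" "run N w x"] run_in assms by blast
qed (use assms in simp)

text \<open>In the step, the triangle relation g h = f g carries the conjugating generator to the
  right, where it meets its inverse.\<close>

lemma run_band:
  "i \<le> k \<Longrightarrow> 1 \<le> i \<Longrightarrow> k < N \<Longrightarrow> x \<in> fractions N \<Longrightarrow>
    nc.eqv N (run N (band i k) x) (nc.pos N (atom N i (Suc k)) x)"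
proof (induction k arbitrary: x rule: dec_induct)
  case base
  let ?a = "atom N i (Suc i)"
  have a: "nc N ?a" using base by (intro nc_atom) auto
  have "nc.eqv N (nc.pos N ?a (nc.pos N ?a (nc.neg N ?a x))) (nc.pos N ?a x)"
    using a base by (intro nc.pos_cong nc.pos_neg nc.pos_in nc.neg_in) auto
  then show ?case by (simp add: band_self)
next
  case (step k)
  let ?g = "atom N (Suc k) (Suc (Suc k))" and ?h = "atom N i (Suc k)" and ?f = "atom N i (Suc (Suc k))"
  have a: "nc N ?g" "nc N ?h" "nc N ?f" using step by (auto intro!: nc_atom)
  have n: "nc.neg N ?g x \<in> fractions N" using a step by (intro nc.neg_in) auto
  have r: "run N (band i k) (nc.neg N ?g x) \<in> fractions N"
    using step n by (intro run_in braid_word_band) auto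
  have in1: "nc.pos N s y \<in> fractions N" if "nc N s" "y \<in> fractions N" for s y
    using that by (intro nc.pos_in) auto
  have "nc.eqv N (nc.pos N ?g (run N (band i k) (nc.neg N ?g x))) (nc.pos N ?g (nc.pos N ?h (nc.neg N ?g x)))"
    using a step n r in1 by (intro nc.pos_cong) auto
  also have "nc.pos N ?g (nc.pos N ?h (nc.neg N ?g x)) = nc.pos N ?f (nc.pos N ?g (nc.neg N ?g x))"
    using step n by (intro pos_dual_pairs dual_pairs_triangle) auto
  finally have 1: "nc.eqv N (nc.pos N ?g (run N (band i k) (nc.neg N ?g x))) (nc.pos N ?f (nc.pos N ?g (nc.neg N ?g x)))" .
  have 2: "nc.eqv N (nc.pos N ?f (nc.pos N ?g (nc.neg N ?g x))) (nc.pos N ?f x)"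
    using a step n in1 by (intro nc.pos_cong nc.pos_neg) auto
  have "nc.eqv N (nc.pos N ?g (run N (band i k) (nc.neg N ?g x))) (nc.pos N ?f x)"
    by (rule nc.eqv_trans [OF 1 2]) (use a r n in1 step.prems in auto)
  then show ?case using step by (simp add: band_Suc)
qed

text \<open>By \<open>run_band\<close> a product of bands acts without denominator, so the greedy
  normal form of a positive word can be recovered from its braid.\<close>

lemma run_bands: "dword N u \<Longrightarrow> nc.eqv N (run N (bands u) (0, [])) (0, acts N u) \<and> acts N u \<in> nc.nf N"
proof (induction u)
  case Nil
  then show ?case by (simp add: acts_def nc.Nil_nf)
next
  case (Cons c u)
  obtain i j where c: "c = (i, j)" by fastforce
  let ?a = "atom N i j"
  have ij: "i \<le> j - 1" "1 \<le> i" "j - 1 < N" "Suc (j - 1) = j" and u: "dword N u" using Cons.prems c by auto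
  have a: "nc N ?a" using Cons.prems c by (auto intro: nc_atom)
  have r: "run N (bands u) (0, []) \<in> fractions N"
    using u by (intro run_in braid_word_bands) (simp_all add: nc.Nil_nf)
  have l: "acts N (c # u) = nc.act N ?a (acts N u)" by (simp add: acts_def c)
  have nf: "acts N (c # u) \<in> nc.nf N"
    unfolding l using a Cons u by (intro nc.act_nf) auto
  have 0: "nc.pos N ?a (0, acts N u) = (0, acts N (c # u))"
    by (simp add: nc.pos_def l)
  have 1: "nc.eqv N (run N (bands (c # u)) (0, [])) (nc.pos N ?a (run N (bands u) (0, [])))"
    using run_band [OF ij(1-3) r] ij(4) by (simp add: c)
  have 2: "nc.eqv N (nc.pos N ?a (run N (bands u) (0, []))) (nc.pos N ?a (0, acts N u))"
    using a r Cons.IH [OF u] by (intro nc.pos_cong) auto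
  have in1: "nc.pos N ?a (run N (bands u) (0, [])) \<in> fractions N"
    using a r by (intro nc.pos_in) auto
  have in2: "run N (bands (c # u)) (0, []) \<in> fractions N"
    using Cons.prems by (intro run_in braid_word_bands) (simp_all add: nc.Nil_nf)
  have "nc.eqv N (run N (bands (c # u)) (0, [])) (0, acts N (c # u))"
    using nc.eqv_trans [OF 1 2 in2 in1] nf by (simp add: 0)
  with nf show ?case by blast
qed

text \<open>Equal braids send the trivial fraction to equivalent fractions. With both exponents 0,
  \<open>eqv\<close> is equality of normal forms, and these determine the monoid element.\<close>

lemma dual_eq_if_braid_eq:
  assumes "dword N u" "dword N v" "braid_eq N (bands u) (bands v)"
  shows "dual_eq u v"
proof -
  note [simp] = nc.Nil_nf
  have r: "run N (bands w) (0, []) \<in> fractions N" if "dword N w" for w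
    using that by (intro run_in braid_word_bands) simp_all
  have "nc.eqv N (run N (bands u) (0, [])) (run N (bands v) (0, []))"
    using run_eq [OF assms(3) braid_word_bands [OF assms(1)]] by simp
  then have "nc.eqv N (run N (bands u) (0, [])) (0, acts N v)"
    by (rule nc.eqv_trans) (use run_bands assms r in auto)
  moreover have "nc.eqv N (0, acts N u) (run N (bands u) (0, []))"
    using run_bands assms nc.eqv_sym by blast
  ultimately have "nc.eqv N (0, acts N u) (0, acts N v)"
    using nc.eqv_trans [of N "(0, acts N u)" "run N (bands u) (0, [])" "(0, acts N v)"]
      run_bands assms r by simp
  then show ?thesis
    using dual_eq_if_acts_eq assms by (simp add: nc.eqv_def)
qed

section \<open>Positive words under added strings and shifts\<close>

lemma strongly_quasipositive_iff:
  "strongly_quasipositive n w \<longleftrightarrow> (\<exists>u. dword n u \<and> braid_eq n w (bands u))"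
proof
  assume "strongly_quasipositive n w"
  then obtain ps where ps: "\<forall>(j, k) \<in> set ps. 1 \<le> j \<and> j \<le> k \<and> k < n"
    "braid_eq n w (concat (map (\<lambda>(j, k). band j k) ps))"
    by (auto simp: strongly_quasipositive_def)
  let ?u = "map (\<lambda>(j, k). (j, Suc k)) ps"
  have "dword n ?u" using ps(1) by (auto simp: dword_def)
  moreover have "bands ?u = concat (map (\<lambda>(j, k). band j k) ps)"
    by (simp add: bands_def comp_def case_prod_unfold)
  ultimately show "\<exists>u. dword n u \<and> braid_eq n w (bands u)" using ps(2) by metis
next
  assume "\<exists>u. dword n u \<and> braid_eq n w (bands u)"
  then obtain u where u: "dword n u" "braid_eq n w (bands u)" by blast
  let ?ps = "map (\<lambda>(i, j). (i, j - 1)) u"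
  have "\<forall>(j, k) \<in> set ?ps. 1 \<le> j \<and> j \<le> k \<and> k < n" using u(1) by (auto simp: dword_def)
  moreover have bands: "bands u = concat (map (\<lambda>(j, k). band j k) ?ps)"
    by (simp add: bands_def comp_def case_prod_unfold)
  have "braid_eq n w (concat (map (\<lambda>(j, k). band j k) ?ps))"
    using u(2) by (simp only: bands)
  ultimately show "strongly_quasipositive n w"
    unfolding strongly_quasipositive_def by blast
qed

lemma braid_eq_mono: assumes "n \<le> n'" "braid_eq n u v" shows "braid_eq n' u v"
proof -
  have "braid_step n' x y" if "braid_step n x y" for x y
    using that
  proof cases
    case (cancel i u b v)
    then show ?thesis using assms(1) by (auto intro!: braid_step.cancel [of i n' u b v, simplified])
  next
    case (comm i j u v)
    then show ?thesis using assms(1) by (auto intro!: braid_step.comm [of i n' j u v, simplified])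
  next
    case (braid i u v)
    then show ?thesis using assms(1) by (auto intro!: braid_step.braid [of i n' u v, simplified])
  qed
  then show ?thesis using braid_eq_lift [of n n' "\<lambda>x. x"] assms(2) by blast
qed

lemma shift_simps [simp]:
  "shift m [] = []" "shift m ((i, b) # u) = (m + i, b) # shift m u" "shift m (u @ v) = shift m u @ shift m v"
  by (simp_all add: shift_def)

lemma braid_eq_shift: assumes "braid_eq n u v" shows "braid_eq (m + n) (shift m u) (shift m v)"
proof (rule braid_eq_lift [OF _ assms])
  fix x y assume "braid_step n x y"
  then show "braid_step (m + n) (shift m x) (shift m y)"
  proof cases
    case (cancel i u b v)
    then show ?thesis using braid_step.cancel [of "m + i" "m + n" "shift m u" b "shift m v"] by simp
  next
    case (comm i j u v)
    then show ?thesis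
      using braid_step.comm [of "m + i" "m + n" "m + j" "shift m u" "shift m v"] by simp
  next
    case (braid i u v)
    then show ?thesis using braid_step.braid [of "m + i" "m + n" "shift m u" "shift m v"] by simp
  qed
qed

lemma braid_word_shift: "braid_word n w \<Longrightarrow> braid_word (m + n) (shift m w)"
  by (induction w) auto

lemma shift_letters: "braid_word n w \<Longrightarrow> a \<in> fst ` set (shift m w) \<Longrightarrow> m < a"
  by (auto simp: shift_def braid_word_def)

lemma shift_band: "j \<le> k \<Longrightarrow> shift m (band j k) = band (m + j) (m + k)"
proof (induction k rule: dec_induct)
  case (step k)
  then show ?case using band_Suc [of "m + j" "m + k"] by (simp add: band_Suc)
qed (simp add: band_self)

definition dshift :: "nat \<Rightarrow> dword \<Rightarrow> dword" where
  "dshift m u = map (\<lambda>(i, j). (m + i, m + j)) u"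

lemma dshift_simps [simp]:
  "dshift m [] = []" "dshift m ((i, j) # u) = (m + i, m + j) # dshift m u"
  by (simp_all add: dshift_def)

lemma shift_bands: "dword n u \<Longrightarrow> shift m (bands u) = bands (dshift m u)"
proof (induction u)
  case (Cons c u)
  obtain i j where c: "c = (i, j)" by fastforce
  have "m + (j - 1) = m + j - 1" using Cons.prems c by auto
  then show ?case using Cons c by (auto simp: shift_band)
qed simp

lemma dword_dshift: "dword n u \<Longrightarrow> dword (m + n) (dshift m u)"
  by (induction u) auto

lemma dword_mono: "n \<le> n' \<Longrightarrow> dword n u \<Longrightarrow> dword n' u"
  by (auto simp: dword_def)

section \<open>Splitting words along two blocks of strings\<close>

definition lower :: "nat \<Rightarrow> dword \<Rightarrow> dword" where
  "lower m u = filter (\<lambda>(i, j). j \<le> m) u"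

definition upper :: "nat \<Rightarrow> dword \<Rightarrow> dword" where
  "upper m u = map (\<lambda>(i, j). (i - m, j - m)) (filter (\<lambda>(i, j). m < i) u)"

definition split_word :: "nat \<Rightarrow> dword \<Rightarrow> bool" where
  "split_word m u \<longleftrightarrow> (\<forall>(i, j) \<in> set u. i < j \<and> (j \<le> m \<or> m < i))"

lemma block_simps [simp]:
  "lower m [] = []" "lower m ((i, j) # u) = (if j \<le> m then (i, j) # lower m u else lower m u)"
  "lower m (u @ v) = lower m u @ lower m v"
  "upper m [] = []" "upper m ((i, j) # u) = (if m < i then (i - m, j - m) # upper m u else upper m u)"
  "upper m (u @ v) = upper m u @ upper m v"
  "split_word m []" "split_word m ((i, j) # u) \<longleftrightarrow> i < j \<and> (j \<le> m \<or> m < i) \<and> split_word m u"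
  "split_word m (u @ v) \<longleftrightarrow> split_word m u \<and> split_word m v"
  by (auto simp: lower_def upper_def split_word_def)

text \<open>The two letters on any side of a triangle relation share a string, so all three strings
  lie in one block; the other relations only permute letters. Restricted to a block, a step either
  remains a step or becomes trivial.\<close>

lemma dual_step_split:
  assumes "dual_step u v" "split_word m u \<or> split_word m v"
  shows "split_word m u \<and> split_word m v \<and> dual_eq (lower m u) (lower m v) \<and> dual_eq (upper m u) (upper m v)"
  using assms
proof cases
  case (tri1 i j k p s)
  then show ?thesis using assms(2)
    dual_eq_step [OF dual_step.tri1 [of i j k "lower m p" "lower m s"]]
    dual_eq_step [OF dual_step.tri1 [of "i - m" "j - m" "k - m" "upper m p" "upper m s"]]
    by auto
next
  case (tri2 i j k p s)
  then show ?thesis using assms(2)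
    dual_eq_step [OF dual_step.tri2 [of i j k "lower m p" "lower m s"]]
    dual_eq_step [OF dual_step.tri2 [of "i - m" "j - m" "k - m" "upper m p" "upper m s"]]
    by auto
next
  case (apart i j k l p s)
  then show ?thesis using assms(2)
    dual_eq_step [OF dual_step.apart [of i j k l "lower m p" "lower m s"]]
    dual_eq_step [OF dual_step.apart [of "i - m" "j - m" "k - m" "l - m" "upper m p" "upper m s"]]
    by auto
next
  case (nested i k l j p s)
  then show ?thesis using assms(2)
    dual_eq_step [OF dual_step.nested [of i k l j "lower m p" "lower m s"]]
    dual_eq_step [OF dual_step.nested [of "i - m" "k - m" "l - m" "j - m" "upper m p" "upper m s"]]
    by auto
qed

lemma dual_eq_split:
  assumes "dual_eq u v" "split_word m u"
  shows "split_word m v \<and> dual_eq (lower m u) (lower m v) \<and> dual_eq (upper m u) (upper m v)"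
  using assms(1) unfolding dual_eq_def
proof (induction rule: rtranclp_induct)
  case (step v w)
  then have "split_word m w \<and> dual_eq (lower m v) (lower m w) \<and> dual_eq (upper m v) (upper m w)"
    using dual_step_split [of v w m] dual_step_split [of w v m] dual_eq_sym by auto
  then show ?case using step.IH unfolding dual_eq_def [symmetric] using dual_eq_trans by blast
qed (use assms(2) in simp)

lemma lower_id: "dword m u \<Longrightarrow> lower m u = u \<and> upper m u = [] \<and> split_word m u"
  by (induction u) auto

lemma upper_dshift: "dword n u \<Longrightarrow> upper m (dshift m u) = u \<and> lower m (dshift m u) = [] \<and> split_word m (dshift m u)"
  by (induction u) auto

lemma dword_lower: "dword (m + n) u \<Longrightarrow> dword m (lower m u)"
  by (induction u) auto

lemma dword_upper: "dword (m + n) u \<Longrightarrow> dword n (upper m u)"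
  by (induction u) auto

theorem theorem1p3:
  fixes m n :: nat and X1 X2 :: bword
  assumes "braid_word m X1" and "braid_word n X2"
  shows "strongly_quasipositive (m + n) (X1 @ shift m X2) \<longleftrightarrow>
         strongly_quasipositive m X1 \<and> strongly_quasipositive n X2"
proof
  assume "strongly_quasipositive m X1 \<and> strongly_quasipositive n X2"
  then obtain u1 u2 where u: "dword m u1" "braid_eq m X1 (bands u1)" "dword n u2" "braid_eq n X2 (bands u2)"
    by (auto simp: strongly_quasipositive_iff)
  have "braid_eq (m + n) (X1 @ shift m X2) (bands u1 @ shift m (bands u2))"
    using u by (intro braid_eq_append braid_eq_shift braid_eq_mono [of m "m + n"]) auto
  also have "bands u1 @ shift m (bands u2) = bands (u1 @ dshift m u2)"
    using u shift_bands by simp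
  finally show "strongly_quasipositive (m + n) (X1 @ shift m X2)"
    using u dword_mono [of m "m + n" u1] dword_dshift [of n u2 m]
    by (auto simp: strongly_quasipositive_iff intro!: exI [of _ "u1 @ dshift m u2"])
next
  assume "strongly_quasipositive (m + n) (X1 @ shift m X2)"
  then obtain Z where Z: "dword (m + n) Z" "braid_eq (m + n) (X1 @ shift m X2) (bands Z)"
    by (auto simp: strongly_quasipositive_iff)
  obtain A1 P1 where 1: "dword m A1" "dword m P1" "braid_eq m (bands A1 @ X1) (bands P1)"
    using denominator [OF assms(1)] by blast
  obtain A2 P2 where 2: "dword n A2" "dword n P2" "braid_eq n (bands A2 @ X2) (bands P2)"
    using denominator [OF assms(2)] by blast
  have b1: "braid_word (m + n) X1" using assms(1) by (auto simp: braid_word_def)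
  \<comment> \<open>The generator with index \<open>m\<close> occurs in neither factor, so the
    indices differ by at least two.\<close>
  have c: "commute (m + n) X1 (shift m (bands A2))"
  proof (rule commute_far [OF b1])
    show "braid_word (m + n) (shift m (bands A2))"
      using 2 by (intro braid_word_shift braid_word_bands)
    fix a b assume "a \<in> fst ` set X1" "b \<in> fst ` set (shift m (bands A2))"
    then have "a < m" "m < b"
      using assms(1) shift_letters [OF braid_word_bands [OF 2(1)]] by (auto simp: braid_word_def)
    then show "a + 2 \<le> b" by simp
  qed
  have "braid_eq (m + n) (bands (A1 @ dshift m A2 @ Z)) (bands (A1 @ dshift m A2) @ X1 @ shift m X2)"
    using braid_eq_append [OF braid_eq_refl braid_eq_sym [OF Z(2)], of "bands (A1 @ dshift m A2)"] by simp
  also have "bands (A1 @ dshift m A2) @ X1 @ shift m X2 = bands A1 @ shift m (bands A2) @ X1 @ shift m X2"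
    using shift_bands [OF 2(1)] by simp
  also have "braid_eq (m + n) \<dots> (bands A1 @ X1 @ shift m (bands A2) @ shift m X2)"
    by (rule braid_eq_ctx [OF braid_eq_sym [OF c [unfolded commute_def]], where p = "bands A1" and s = "shift m X2"])
      simp_all
  also have "\<dots> = (bands A1 @ X1) @ shift m (bands A2 @ X2)" by simp
  also have "braid_eq (m + n) \<dots> (bands P1 @ shift m (bands P2))"
    using 1 2 by (intro braid_eq_append braid_eq_shift braid_eq_mono [of m "m + n"]) auto
  also have "\<dots> = bands (P1 @ dshift m P2)" using shift_bands [OF 2(2)] by simp
  finally have "dual_eq (A1 @ dshift m A2 @ Z) (P1 @ dshift m P2)"
    using Z 1 2 dword_mono [of m "m + n"]
    by (intro dual_eq_if_braid_eq [of "m + n"]) (simp_all add: dword_dshift)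
  \<comment> \<open>The word made of \<open>P1\<close> and the shifted \<open>P2\<close> is split.
    The relations carry this over to the word containing \<open>Z\<close> and can be restricted to
    each block.\<close>
  then have "dual_eq (lower m (P1 @ dshift m P2)) (lower m (A1 @ dshift m A2 @ Z)) \<and>
      dual_eq (upper m (P1 @ dshift m P2)) (upper m (A1 @ dshift m A2 @ Z))"
    using dual_eq_split [OF dual_eq_sym, of "A1 @ dshift m A2 @ Z" "P1 @ dshift m P2" m]
      lower_id [OF 1(2)] upper_dshift [OF 2(2)] by (metis block_simps(9))
  then have eq: "dual_eq P1 (A1 @ lower m Z)" "dual_eq P2 (A2 @ upper m Z)"
    using lower_id [OF 1(1)] lower_id [OF 1(2)] upper_dshift [OF 2(1)] upper_dshift [OF 2(2)] by simp_all
  \<comment> \<open>Each denominator is cancelled in its own smaller braid group, leaving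
    \<open>X1\<close> and \<open>X2\<close> as products of bands.\<close>
  have "braid_eq m (bands A1 @ X1) (bands A1 @ bands (lower m Z))"
    using braid_eq_trans [OF 1(3)] dual_eq_braid_eq [OF eq(1) 1(2)] by simp
  then have r1: "braid_eq m X1 (bands (lower m Z))"
    using braid_word_bands [OF 1(1)] by (rule braid_eq_cancel_left)
  have "braid_eq n (bands A2 @ X2) (bands A2 @ bands (upper m Z))"
    using braid_eq_trans [OF 2(3)] dual_eq_braid_eq [OF eq(2) 2(2)] by simp
  then have r2: "braid_eq n X2 (bands (upper m Z))"
    using braid_word_bands [OF 2(1)] by (rule braid_eq_cancel_left)
  show "strongly_quasipositive m X1 \<and> strongly_quasipositive n X2"
    using r1 r2 dword_lower [OF Z(1)] dword_upper [OF Z(1)] by (auto simp: strongly_quasipositive_iff)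
qed

end
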